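(* Let $f=h+\overline{g}$ be a harmonic mapping of the open unit disk $\mathbb{D}$ whose dilatation $\omega=g'/h'=q^2$ is the square of a meromorphic function $q$ in $\mathbb{D}$. Let $\mathbf{g}=e^{2\rho}\mathbf{g}_0$ be a metric in $\mathbb{D}$ conformal to the Euclidean metric $\mathbf{g}_0$, and suppose that any two points in $\mathbb{D}$ can be joined by a geodesic in the metric $\mathbf{g}$ of length less than $\delta$, for some $0<\delta\leq\infty$. If $$\left|\mathcal{S} f -2\left(\rho_{zz}-\rho_z^2\right)\right|+e^{2\sigma}|K|\leq \frac{2\pi^2e^{2\rho}}{\delta^2}+2\rho_{z\bar{z}}\qquad\text{at every } z\in\mathbb{D},$$ then the lift $\widetilde{f}$ is injective in $\mathbb{D}$.
   Context: $\mathbb{D}=\{|z|<1\}$; subscripts $z,\bar z$ denote the Wirtinger derivatives, $\partial_z=\frac12(\partial_x-i\partial_y)$. A harmonic mapping of $\mathbb{D}$ is a complex-valued harmonic function written $f=h+\overline{g}$ with $h,g$ analytic in $\mathbb{D}$; it is assumed that $|h'|+|g'|\neq 0$ in $\mathbb{D}$, but $f$ is not required to be locally univalent. If its dilatation is $\omega=g'/h'=q^2$ with $q$ meromorphic, its Weierstrass--Enneper lift is the conformal immersion $\widetilde f=(U,V,W):\mathbb{D}\to\mathbb{R}^3$ onto a minimal surface $\Sigma=\widetilde f(\mathbb{D})$ given by $U=\mathrm{Re}\,f$, $V=\mathrm{Im}\,f$, $W(z)=2\,\mathrm{Im}\int_{z_0}^z h'(\zeta)q(\zeta)\,d\zeta$,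 for a fixed base point $z_0\in\mathbb{D}$. The first fundamental form of the surface is $e^{2\sigma}|dz|^2$ with $e^\sigma=|h'|+|g'|$; $K=-e^{-2\sigma}\Delta\sigma\le 0$ is the Gauss curvature of the surface at $\widetilde f(z)$. The Schwarzian derivative of $f$ is $\mathcal{S}f=2(\sigma_{zz}-\sigma_z^2)$. $\mathbf{g}_0=|dz|^2$ is the Euclidean metric and $\rho:\mathbb{D}\to\mathbb{R}$ is smooth. When $\delta=\infty$ the term $2\pi^2e^{2\rho}/\delta^2$ is read as $0$. *)

theory Defs
  imports "HOL-Complex_Analysis.Complex_Analysis"
begin

abbreviation unit_disk :: "complex set" (\<open>\<bbbD>\<close>)
  where "\<bbbD> \<equiv> ball 0 1"


subsection \<open>Real differential calculus in the plane\<close>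

definition partial_x :: "(complex \<Rightarrow> 'a::real_normed_vector) \<Rightarrow> complex \<Rightarrow> 'a"
  where "partial_x F z = frechet_derivative F (at z) 1"

definition partial_y :: "(complex \<Rightarrow> 'a::real_normed_vector) \<Rightarrow> complex \<Rightarrow> 'a"
  where "partial_y F z = frechet_derivative F (at z) \<i>"

definition laplacian :: "(complex \<Rightarrow> 'a::real_normed_vector) \<Rightarrow> complex \<Rightarrow> 'a"
  where "laplacian F z = partial_x (partial_x F) z + partial_y (partial_y F) z"

definition wirtinger :: "(complex \<Rightarrow> complex) \<Rightarrow> complex \<Rightarrow> complex"
  where "wirtinger F z = (partial_x F z - \<i> * partial_y F z) / 2"

definition wirtinger_bar :: "(complex \<Rightarrow> complex) \<Rightarrow> complex \<Rightarrow> complex"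
  where "wirtinger_bar F z = (partial_x F z + \<i> * partial_y F z) / 2"

text \<open>Meant for open \<open>S\<close>.\<close>

primrec Ck_on :: "nat \<Rightarrow> (complex \<Rightarrow> 'a::real_normed_vector) \<Rightarrow> complex set \<Rightarrow> bool"
  where
    "Ck_on 0 F S \<longleftrightarrow> continuous_on S F"
  | "Ck_on (Suc k) F S \<longleftrightarrow>
       (\<forall>z\<in>S. F differentiable (at z)) \<and> Ck_on k (partial_x F) S \<and> Ck_on k (partial_y F) S"

definition smooth_on :: "(complex \<Rightarrow> 'a::real_normed_vector) \<Rightarrow> complex set \<Rightarrow> bool"
  where "smooth_on F S \<longleftrightarrow> (\<forall>k. Ck_on k F S)"


subsection \<open>Harmonic mappings and their lifts\<close>

definition harmonic_mapping ::
    "(complex \<Rightarrow> complex) \<Rightarrow> (complex \<Rightarrow> complex) \<Rightarrow> (complex \<Rightarrow> complex) \<Rightarrow> bool"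
  where "harmonic_mapping f h g \<longleftrightarrow>
    h holomorphic_on \<bbbD> \<and> g holomorphic_on \<bbbD> \<and>
    (\<forall>z\<in>\<bbbD>. f z = h z + cnj (g z)) \<and>
    (\<forall>z\<in>\<bbbD>. norm (deriv h z) + norm (deriv g z) \<noteq> 0)"

text \<open>
  The identity \<open>g'/h' = q\<^sup>2\<close> is one of meromorphic functions, so it is required outside a set of
  isolated points; in particular \<open>h'\<close> does not vanish identically.
\<close>

definition dilatation_is_square ::
    "(complex \<Rightarrow> complex) \<Rightarrow> (complex \<Rightarrow> complex) \<Rightarrow> (complex \<Rightarrow> complex) \<Rightarrow> bool"
  where "dilatation_is_square h g q \<longleftrightarrow>
    q meromorphic_on \<bbbD> \<and>
    (\<forall>\<^sub>\<approx>z\<in>\<bbbD>. deriv h z \<noteq> 0 \<and> deriv g z / deriv h z = (q z)\<^sup>2)"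

text \<open>
  From \<open>(h' q)\<^sup>2 = h' g'\<close> off isolated points, the singularities of \<open>h' q\<close> are removable. The
  integral is therefore independent of the path in the disk, and of the values of \<open>q\<close> at
  isolated points; it is taken along the segment from \<open>z\<^sub>0\<close> to \<open>z\<close>.
\<close>

definition lift ::
    "(complex \<Rightarrow> complex) \<Rightarrow> (complex \<Rightarrow> complex) \<Rightarrow> (complex \<Rightarrow> complex) \<Rightarrow> complex \<Rightarrow>
      complex \<Rightarrow> real ^ 3"
  where "lift f h q z\<^sub>0 z =
    vector [Re (f z), Im (f z),
            2 * Im (contour_integral (linepath z\<^sub>0 z) (\<lambda>\<zeta>. deriv h \<zeta> * q \<zeta>))]"

definition log_factor :: "(complex \<Rightarrow> complex) \<Rightarrow> (complex \<Rightarrow> complex) \<Rightarrow> complex \<Rightarrow> real"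
  where "log_factor h g z = ln (norm (deriv h z) + norm (deriv g z))"

definition gauss_curvature :: "(complex \<Rightarrow> complex) \<Rightarrow> (complex \<Rightarrow> complex) \<Rightarrow> complex \<Rightarrow> real"
  where "gauss_curvature h g z =
    - exp (- 2 * log_factor h g z) * laplacian (log_factor h g) z"

definition harmonic_schwarzian ::
    "(complex \<Rightarrow> complex) \<Rightarrow> (complex \<Rightarrow> complex) \<Rightarrow> complex \<Rightarrow> complex"
  where "harmonic_schwarzian h g z =
    (let \<sigma> = \<lambda>w. complex_of_real (log_factor h g w)
     in 2 * (wirtinger (wirtinger \<sigma>) z - (wirtinger \<sigma> z)\<^sup>2))"


subsection \<open>Geodesics of a conformal metric on the disk\<close>

text \<open>
  For the metric \<open>e\<^bsup>2\<rho>\<^esup>|dz|\<^sup>2\<close> the Levi-Civita connection has, in the coordinate \<open>z\<close>, the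
  Christoffel symbols \<open>\<Gamma>\<^bsup>z\<^esup>\<^bsub>zz\<^esub> = 2\<rho>\<^sub>z\<close> and its conjugate, the others being zero. Hence
  the geodesic equation is \<open>\<gamma>'' + 2\<rho>\<^sub>z(\<gamma>) \<gamma>'\<^sup>2 = 0\<close>. Geodesics are affinely parametrized over
  \<open>[0,1]\<close>, need not minimize length, and may be constant.
\<close>

definition conformal_geodesic :: "(complex \<Rightarrow> real) \<Rightarrow> (real \<Rightarrow> complex) \<Rightarrow> bool"
  where "conformal_geodesic \<rho> \<gamma> \<longleftrightarrow>
    path_image \<gamma> \<subseteq> \<bbbD> \<and>
    (\<exists>\<gamma>'. \<forall>t\<in>{0..1}.
        (\<gamma> has_vector_derivative \<gamma>' t) (at t within {0..1}) \<and>
        (\<gamma>' has_vector_derivative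
           - 2 * wirtinger (\<lambda>w. complex_of_real (\<rho> w)) (\<gamma> t) * (\<gamma>' t)\<^sup>2) (at t within {0..1}))"

definition conformal_length :: "(complex \<Rightarrow> real) \<Rightarrow> (real \<Rightarrow> complex) \<Rightarrow> real"
  where "conformal_length \<rho> \<gamma> =
    integral {0..1} (\<lambda>t. exp (\<rho> (\<gamma> t)) * norm (vector_derivative \<gamma> (at t within {0..1})))"

end

theory Submission
  imports Defs
begin

text \<open>
  The proof tests injectivity of the lift along geodesics by a Sturm comparison.

  Let \<open>F\<close> be the lift minus its value at a base point \<open>A\<close> of the disk. Along a curve \<open>\<gamma>\<close> the speed of
  \<open>F \<circ> \<gamma>\<close> is \<open>e\<^sup>\<sigma> |\<gamma>'|\<close>, so for a geodesic of \<open>e\<^bsup>2\<rho>\<^esup>|dz|\<^sup>2\<close>, where \<open>e\<^sup>\<rho> |\<gamma>'|\<close> is constant, the function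
  \<open>w = |F| e\<^bsup>(\<rho> - \<sigma>)/2\<^esup>\<close> is, up to a constant, \<open>|F| / |(F \<circ> \<gamma>)'|\<^bsup>1/2\<^esup>\<close>. For a curve in the line this is the
  familiar solution \<open>\<phi> / |\<phi>'|\<^bsup>1/2\<^esup>\<close> of \<open>u'' + (S\<phi> / 2) u = 0\<close>, with \<open>S\<close> the Schwarzian. For a curve in space, \<open>w\<^bsup>-2\<^esup>\<close> is
  essentially the speed of the image curve under the inversion \<open>F / |F|\<^sup>2\<close>, and the curvature of
  that curve only helps, so that \<open>w\<close> is a supersolution. On a minimal surface the
  remaining normal term is absorbed by the Gauss curvature, and the hypothesis gives
  \<open>w'' \<ge> - \<mu>\<^sup>2 w\<close> wherever \<open>w > 0\<close>, with \<open>\<mu> = \<pi> L / \<delta> < \<pi>\<close> for a geodesic of length \<open>L < \<delta>\<close> that is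
  parametrized over \<open>[0,1]\<close> (any positive \<open>\<mu> < \<pi>\<close> will do if \<open>\<delta> = \<infinity>\<close>). By comparison with \<open>sin (\<mu> t)\<close>, such
  a \<open>w\<close> cannot vanish twice within \<open>[0,1]\<close> (lemma \<open>sturm_positive\<close>). If the lift took the same value
  at two points, \<open>w\<close> would vanish at both ends of the geodesic that joins them.

  The inequality for \<open>w\<close> is an explicit computation. Locally \<open>h' = a\<^sup>2\<close>, \<open>g' = b\<^sup>2\<close> and \<open>h' q = a b\<close>
  with holomorphic \<open>a\<close> and \<open>b\<close> (lemma \<open>local_spinors\<close>), hence \<open>e\<^sup>\<sigma> = |a|\<^sup>2 + |b|\<^sup>2\<close>. In these terms the
  normal component of \<open>F\<close> and the second fundamental form are polynomials, and everything
  reduces to two algebraic identities (lemma \<open>spinor_identities\<close>) and an instance of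
  \<open>2 x y \<le> x\<^sup>2 + y\<^sup>2\<close> (lemma \<open>riccati_bound\<close>).
\<close>

section \<open>Wirtinger calculus\<close>

text \<open>
  The constants \<open>wirtinger\<close> and \<open>wirtinger_bar\<close> are total, with arbitrary values where the function
  is not differentiable. This relation also asserts real differentiability, so that it can be
  composed by rules.
\<close>
definition has_wirtinger :: "(complex \<Rightarrow> complex) \<Rightarrow> complex \<Rightarrow> complex \<Rightarrow> complex \<Rightarrow> bool"
  where "has_wirtinger F p q z \<longleftrightarrow> (F has_derivative (\<lambda>v. p * v + q * cnj v)) (at z)"

lemma has_wirtinger_imp_eq:
  assumes "has_wirtinger F p q z"
  shows "wirtinger F z = p" "wirtinger_bar F z = q"
proof -
  have D: "frechet_derivative F (at z) = (\<lambda>v. p * v + q * cnj v)"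
    using assms frechet_derivative_at unfolding has_wirtinger_def by metis
  show "wirtinger F z = p" "wirtinger_bar F z = q"
    unfolding wirtinger_def wirtinger_bar_def partial_x_def partial_y_def D
    by (simp_all add: algebra_simps)
qed

lemma has_wirtinger_wirtinger:
  assumes "F differentiable (at z)"
  shows "has_wirtinger F (wirtinger F z) (wirtinger_bar F z) z"
proof -
  let ?D = "frechet_derivative F (at z)"
  have D: "(F has_derivative ?D) (at z)"
    using assms frechet_derivative_works by blast
  then interpret D: bounded_linear ?D by (rule has_derivative_bounded_linear)
  have "?D v = wirtinger F z * v + wirtinger_bar F z * cnj v" for v
  proof -
    have "?D v = ?D (Re v *\<^sub>R 1 + Im v *\<^sub>R \<i>)"
      by (rule arg_cong[where f = ?D]) (simp add: complex_eq_iff)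
    also have "\<dots> = Re v * ?D 1 + Im v * ?D \<i>"
      by (simp only: D.add D.scaleR) (simp add: scaleR_conv_of_real)
    also have "\<dots> = wirtinger F z * v + wirtinger_bar F z * cnj v"
      unfolding wirtinger_def wirtinger_bar_def partial_x_def partial_y_def
      by (subst (3 4) complex_eq) (simp add: field_simps complex_eq_iff)
    finally show ?thesis .
  qed
  then have "?D = (\<lambda>v. wirtinger F z * v + wirtinger_bar F z * cnj v)" by blast
  with D show ?thesis unfolding has_wirtinger_def by simp
qed

lemma has_wirtinger_transform:
  assumes "has_wirtinger F p q z" "open U" "z \<in> U" "\<And>w. w \<in> U \<Longrightarrow> F w = G w"
  shows "has_wirtinger G p q z"
  using assms has_derivative_transform_within_open unfolding has_wirtinger_def by blast

lemma has_wirtinger_holomorphic: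
  "(F has_field_derivative d) (at z) \<Longrightarrow> has_wirtinger F d 0 z"
  by (simp add: has_wirtinger_def has_field_derivative_def)

lemma has_wirtinger_cnj:
  "has_wirtinger F p q z \<Longrightarrow> has_wirtinger (\<lambda>w. cnj (F w)) (cnj q) (cnj p) z"
  unfolding has_wirtinger_def by (drule has_derivative_cnj) (simp add: add.commute)

lemma has_wirtinger_const: "has_wirtinger (\<lambda>w. c) 0 0 z"
  by (simp add: has_wirtinger_def)

lemma has_wirtinger_add:
  assumes "has_wirtinger F p q z" "has_wirtinger G p' q' z"
  shows "has_wirtinger (\<lambda>w. F w + G w) (p + p') (q + q') z"
  using assms unfolding has_wirtinger_def
  by (auto intro!: derivative_eq_intros simp: algebra_simps)

lemma has_wirtinger_diff:
  assumes "has_wirtinger F p q z" "has_wirtinger G p' q' z"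
  shows "has_wirtinger (\<lambda>w. F w - G w) (p - p') (q - q') z"
  using assms unfolding has_wirtinger_def
  by (auto intro!: derivative_eq_intros simp: algebra_simps)

lemma has_wirtinger_mult:
  assumes "has_wirtinger F p q z" "has_wirtinger G p' q' z"
  shows "has_wirtinger (\<lambda>w. F w * G w) (p * G z + F z * p') (q * G z + F z * q') z"
  using assms unfolding has_wirtinger_def
  by (auto intro!: derivative_eq_intros simp: algebra_simps)

lemma has_wirtinger_divide:
  assumes "has_wirtinger F p q z" "has_wirtinger G p' q' z" "G z \<noteq> 0"
  shows "has_wirtinger (\<lambda>w. F w / G w)
           (p / G z - F z * p' / (G z)\<^sup>2) (q / G z - F z * q' / (G z)\<^sup>2) z"
  using assms unfolding has_wirtinger_def
  by (auto intro!: derivative_eq_intros simp: field_simps power2_eq_square)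

lemma has_wirtinger_Re:
  assumes "has_wirtinger (\<lambda>w. complex_of_real (r w)) p q z"
  shows "(r has_derivative (\<lambda>v. Re (p * v + q * cnj v))) (at z)"
  using has_derivative_Re[OF assms[unfolded has_wirtinger_def]] by simp

lemma has_wirtinger_ln:
  assumes "has_wirtinger (\<lambda>w. complex_of_real (r w)) p (cnj p) z" "r z > 0"
  shows "has_wirtinger (\<lambda>w. complex_of_real (ln (r w))) (p / r z) (cnj (p / r z)) z"
proof -
  have "((\<lambda>w. ln (r w)) has_derivative (\<lambda>v. Re (p * v + cnj p * cnj v) / r z)) (at z)"
    using has_wirtinger_Re[OF assms(1)] assms(2)
    by (auto intro!: derivative_eq_intros simp: field_simps)
  from has_derivative_of_real[OF this, where 'a = complex]
  show ?thesis unfolding has_wirtinger_def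
    by (rule has_derivative_eq_rhs) (auto simp: fun_eq_iff complex_eq_iff add_divide_distrib diff_divide_distrib)
qed

lemma has_vector_derivative_compose_wirtinger:
  assumes "has_wirtinger F p q (\<gamma> t)" "(\<gamma> has_vector_derivative v) (at t within S)"
  shows "((\<lambda>s. F (\<gamma> s)) has_vector_derivative p * v + q * cnj v) (at t within S)"
proof -
  have "(F has_derivative (\<lambda>v. p * v + q * cnj v)) (at (\<gamma> t) within \<gamma> ` S)"
    using assms(1) has_derivative_at_withinI unfolding has_wirtinger_def by blast
  from diff_chain_within[OF assms(2)[unfolded has_vector_derivative_def] this]
  show ?thesis unfolding has_vector_derivative_def o_def
    by (rule has_derivative_eq_rhs) (auto simp: fun_eq_iff scaleR_conv_of_real algebra_simps)
qed

lemma has_real_derivative_compose_wirtinger: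
  assumes "has_wirtinger (\<lambda>w. complex_of_real (r w)) p (cnj p) (\<gamma> t)"
    and "(\<gamma> has_vector_derivative v) (at t within S)"
  shows "((\<lambda>s. r (\<gamma> s)) has_real_derivative 2 * Re (p * v)) (at t within S)"
proof -
  have "((\<lambda>s. Re (complex_of_real (r (\<gamma> s)))) has_vector_derivative
           Re (p * v + cnj p * cnj v)) (at t within S)"
    using has_vector_derivative_compose_wirtinger[OF assms]
    by (rule bounded_linear.has_vector_derivative[OF bounded_linear_Re])
  then show ?thesis by (simp add: has_real_derivative_iff_has_vector_derivative)
qed

text \<open>
  This is \<open>\<Delta> = 4 \<partial>\<^bsub>cnj z\<^esub> \<partial>\<^bsub>z\<^esub>\<close>, stated for a real function whose first Wirtinger derivative is known on a
  neighbourhood: the iterated partial derivatives in the Laplacian need more than the point \<open>z\<close>.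
\<close>
lemma laplacian_eq_wirtinger:
  fixes r :: "complex \<Rightarrow> real"
  assumes "open U" "z \<in> U"
    and r: "\<And>w. w \<in> U \<Longrightarrow> has_wirtinger (\<lambda>w. complex_of_real (r w)) (P w) (cnj (P w)) w"
    and P: "has_wirtinger P p q z"
  shows "laplacian r z = 4 * Re q"
proof -
  have D: "frechet_derivative r (at w) = (\<lambda>v. 2 * Re (P w * v))" if "w \<in> U" for w
  proof -
    have "(r has_derivative (\<lambda>v. Re (P w * v + cnj (P w) * cnj v))) (at w)"
      using r[OF that] by (rule has_wirtinger_Re)
    from frechet_derivative_at[OF this, symmetric]
    show ?thesis by (simp add: fun_eq_iff algebra_simps)
  qed
  note P' = P[unfolded has_wirtinger_def]
  have "((\<lambda>w. 2 * Re (P w)) has_derivative (\<lambda>v. 2 * Re (p * v + q * cnj v))) (at z)"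
    using P' by (auto intro!: derivative_eq_intros)
  then have "(partial_x r has_derivative (\<lambda>v. 2 * Re (p * v + q * cnj v))) (at z)"
    by (rule has_derivative_transform_within_open[OF _ assms(1,2)]) (simp add: partial_x_def D)
  then have x: "partial_x (partial_x r) z = 2 * Re (p + q)"
    by (simp add: partial_x_def frechet_derivative_at[symmetric])
  have "((\<lambda>w. - 2 * Im (P w)) has_derivative (\<lambda>v. - 2 * Im (p * v + q * cnj v))) (at z)"
    using P' by (auto intro!: derivative_eq_intros)
  then have "(partial_y r has_derivative (\<lambda>v. - 2 * Im (p * v + q * cnj v))) (at z)"
    by (rule has_derivative_transform_within_open[OF _ assms(1,2)]) (simp add: partial_y_def D)
  then have y: "partial_y (partial_y r) z = - 2 * Im (p * \<i> + q * cnj \<i>)"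
    by (simp only: partial_y_def frechet_derivative_at[symmetric])
  show ?thesis unfolding laplacian_def x y by simp
qed

text \<open>
  Smoothness speaks of the real partial derivatives of \<open>\<rho>\<close>, the bound on the Schwarzian of the
  Wirtinger derivatives of its complexification; here one is turned into the other.
\<close>
lemma smooth_on_has_wirtinger:
  fixes \<rho> :: "complex \<Rightarrow> real"
  assumes "smooth_on \<rho> U" "open U" "z \<in> U"
  defines "\<rho>\<^sub>c \<equiv> \<lambda>w. complex_of_real (\<rho> w)"
  shows "has_wirtinger \<rho>\<^sub>c (wirtinger \<rho>\<^sub>c z) (cnj (wirtinger \<rho>\<^sub>c z)) z"
    and "has_wirtinger (wirtinger \<rho>\<^sub>c) (wirtinger (wirtinger \<rho>\<^sub>c) z)
           (wirtinger_bar (wirtinger \<rho>\<^sub>c) z) z"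
proof -
  have "Ck_on 2 \<rho> U" using assms(1) unfolding smooth_on_def by blast
  then have d: "\<And>w. w \<in> U \<Longrightarrow> \<rho> differentiable (at w)"
    and dx: "partial_x \<rho> differentiable (at z)" and dy: "partial_y \<rho> differentiable (at z)"
    using \<open>z \<in> U\<close> by (auto simp: numeral_2_eq_2)
  have D: "(\<rho>\<^sub>c has_derivative (\<lambda>v. complex_of_real (frechet_derivative \<rho> (at w) v))) (at w)"
    if "w \<in> U" for w
    unfolding \<rho>\<^sub>c_def using d[OF that] frechet_derivative_works has_derivative_of_real by blast
  then have F: "frechet_derivative \<rho>\<^sub>c (at w) = (\<lambda>v. complex_of_real (frechet_derivative \<rho> (at w) v))"
    if "w \<in> U" for w
    using that frechet_derivative_at by metis
  have W: "wirtinger \<rho>\<^sub>c w = (complex_of_real (partial_x \<rho> w) - \<i> * complex_of_real (partial_y \<rho> w)) / 2"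
    and Wb: "wirtinger_bar \<rho>\<^sub>c w = cnj (wirtinger \<rho>\<^sub>c w)"
    if "w \<in> U" for w
    using F[OF that] by (simp_all add: wirtinger_def wirtinger_bar_def partial_x_def partial_y_def)
  have "has_wirtinger \<rho>\<^sub>c (wirtinger \<rho>\<^sub>c z) (wirtinger_bar \<rho>\<^sub>c z) z"
    using D[OF \<open>z \<in> U\<close>] differentiable_def has_wirtinger_wirtinger by blast
  then show "has_wirtinger \<rho>\<^sub>c (wirtinger \<rho>\<^sub>c z) (cnj (wirtinger \<rho>\<^sub>c z)) z"
    using Wb[OF \<open>z \<in> U\<close>] by simp
  have "((\<lambda>w. (complex_of_real (partial_x \<rho> w) - \<i> * complex_of_real (partial_y \<rho> w)) / 2)
          has_derivative
         (\<lambda>v. (complex_of_real (frechet_derivative (partial_x \<rho>) (at z) v)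
               - \<i> * complex_of_real (frechet_derivative (partial_y \<rho>) (at z) v)) / 2)) (at z)"
    using dx[unfolded frechet_derivative_works] dy[unfolded frechet_derivative_works]
    by (auto intro!: derivative_eq_intros)
  then have "(wirtinger \<rho>\<^sub>c has_derivative
         (\<lambda>v. (complex_of_real (frechet_derivative (partial_x \<rho>) (at z) v)
               - \<i> * complex_of_real (frechet_derivative (partial_y \<rho>) (at z) v)) / 2)) (at z)"
    by (rule has_derivative_transform_within_open[OF _ \<open>open U\<close> \<open>z \<in> U\<close>]) (simp add: W)
  then show "has_wirtinger (wirtinger \<rho>\<^sub>c) (wirtinger (wirtinger \<rho>\<^sub>c) z)
           (wirtinger_bar (wirtinger \<rho>\<^sub>c) z) z"
    using differentiable_def has_wirtinger_wirtinger by blast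
qed

section \<open>A Sturm comparison\<close>

text \<open>
  With \<open>s = sin (\<mu> (t - \<alpha>))\<close>, which is positive on the whole of \<open>(\<alpha>, \<beta>]\<close>, the Wronskian
  \<open>W = w' s - w s'\<close> has derivative \<open>s (w'' + \<mu>\<^sup>2 w) \<ge> 0\<close>. If \<open>W \<ge> 0\<close>, then \<open>w / s\<close> increases up to \<open>\<beta>\<close> and
  stays positive. Nothing is known about \<open>w'\<close> near \<open>\<alpha>\<close>, because in the application \<open>w\<close> contains
  the square root of a squared distance that vanishes there, so \<open>W \<ge> 0\<close> has to follow from
  the continuity of \<open>w\<close> alone: if \<open>W \<le> - K < 0\<close> near \<open>\<alpha>\<close>, then \<open>(w / s)' \<le> - K / s\<^sup>2\<close> makes \<open>w / s\<close> grow like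
  \<open>(K / \<mu>) cot (\<mu> (t - \<alpha>))\<close> as \<open>t\<close> decreases to \<open>\<alpha>\<close>, whereas \<open>w\<close> tends to \<open>0\<close>.
\<close>
lemma sturm_positive:
  fixes w w' w'' :: "real \<Rightarrow> real"
  assumes "\<alpha> < \<beta>" "0 < \<mu>" "\<mu> * (\<beta> - \<alpha>) < pi"
    and cont: "continuous_on {\<alpha>..\<beta>} w" and "w \<alpha> = 0"
    and pos: "\<And>t. t \<in> {\<alpha><..<\<beta>} \<Longrightarrow> w t > 0"
    and w': "\<And>t. t \<in> {\<alpha><..<\<beta>} \<Longrightarrow> (w has_real_derivative w' t) (at t)"
    and w'': "\<And>t. t \<in> {\<alpha><..<\<beta>} \<Longrightarrow> (w' has_real_derivative w'' t) (at t)"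
    and ineq: "\<And>t. t \<in> {\<alpha><..<\<beta>} \<Longrightarrow> w'' t \<ge> - (\<mu>\<^sup>2 * w t)"
  shows "w \<beta> > 0"
proof -
  define s where "s t = sin (\<mu> * (t - \<alpha>))" for t
  define c where "c t = cos (\<mu> * (t - \<alpha>))" for t
  define W where "W t = w' t * s t - w t * (\<mu> * c t)" for t
  have s': "(s has_real_derivative \<mu> * c t) (at t)" for t
    unfolding s_def c_def by (auto intro!: derivative_eq_intros)
  have c': "(c has_real_derivative - (\<mu> * s t)) (at t)" for t
    unfolding s_def c_def by (auto intro!: derivative_eq_intros)
  have spos: "s t > 0" if "t \<in> {\<alpha><..\<beta>}" for t
  proof -
    have "\<mu> * (t - \<alpha>) \<le> \<mu> * (\<beta> - \<alpha>)" using that \<open>0 < \<mu>\<close> by simp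
    with \<open>\<mu> * (\<beta> - \<alpha>) < pi\<close> have "\<mu> * (t - \<alpha>) < pi" by linarith
    then show ?thesis unfolding s_def using that \<open>0 < \<mu>\<close>
      by (intro sin_gt_zero) auto
  qed
  have sc: "(s t)\<^sup>2 + (c t)\<^sup>2 = 1" for t by (simp add: s_def c_def)
  have W': "(W has_real_derivative s t * (w'' t + \<mu>\<^sup>2 * w t)) (at t)" if "t \<in> {\<alpha><..<\<beta>}" for t
    unfolding W_def
    by (rule derivative_eq_intros w'[OF that] w''[OF that] s' c' refl)+
       (simp add: algebra_simps power2_eq_square)
  have Wmono: "W t \<le> W u" if "\<alpha> < t" "t \<le> u" "u < \<beta>" for t u
  proof (rule DERIV_nonneg_imp_nondecreasing[OF \<open>t \<le> u\<close>])
    fix x assume "t \<le> x" "x \<le> u"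
    then have x: "x \<in> {\<alpha><..<\<beta>}" using that by auto
    have "0 \<le> s x * (w'' x + \<mu>\<^sup>2 * w x)"
      using spos[of x] ineq[OF x] x by (intro mult_nonneg_nonneg) auto
    then show "\<exists>y. (W has_real_derivative y) (at x) \<and> 0 \<le> y" using W'[OF x] by blast
  qed
  have cont_at: "(w \<longlongrightarrow> 0) (at_right \<alpha>)"
  proof -
    have "(w \<longlongrightarrow> w \<alpha>) (at \<alpha> within {\<alpha>..\<beta>})"
      using cont \<open>\<alpha> < \<beta>\<close> by (simp add: continuous_on_def)
    then show ?thesis using \<open>\<alpha> < \<beta>\<close> \<open>w \<alpha> = 0\<close> by (simp add: at_within_Icc_at_right)
  qed
  have Wpos: "W u \<ge> 0" if u: "u \<in> {\<alpha><..<\<beta>}" for u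
  proof (rule ccontr)
    assume "\<not> W u \<ge> 0"
    define K where "K = - W u"
    have "K > 0" using \<open>\<not> W u \<ge> 0\<close> by (simp add: K_def)
    \<comment> \<open>The subtracted term is a primitive of \<open>- K / s\<^sup>2\<close>, so \<open>\<phi>\<close> is nonincreasing where \<open>W \<le> - K\<close>.\<close>
    define \<phi> where "\<phi> t = (w t - (K / \<mu>) * c t) / s t" for t
    have \<phi>': "(\<phi> has_real_derivative (W t + K) / (s t)\<^sup>2) (at t)" if "t \<in> {\<alpha><..<\<beta>}" for t
    proof -
      have "s t \<noteq> 0" using spos[of t] that by auto
      have "((\<lambda>t. w t - (K / \<mu>) * c t) has_real_derivative w' t + K * s t) (at t)"
        using \<open>0 < \<mu>\<close> by (auto intro!: derivative_eq_intros w'[OF that] c')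
      from DERIV_divide[OF this s' \<open>s t \<noteq> 0\<close>]
      have "(\<phi> has_real_derivative
          ((w' t + K * s t) * s t - (w t - (K / \<mu>) * c t) * (\<mu> * c t)) / (s t * s t)) (at t)"
        unfolding \<phi>_def .
      moreover have "(w' t + K * s t) * s t - (w t - (K / \<mu>) * c t) * (\<mu> * c t)
          = W t + K * ((s t)\<^sup>2 + (c t)\<^sup>2)"
      proof -
        have "(w' t + K * s t) * s t - (w t - (K / \<mu>) * c t) * (\<mu> * c t)
            = W t + K * (s t)\<^sup>2 + ((K / \<mu>) * \<mu>) * (c t)\<^sup>2"
          unfolding W_def by (simp only: power2_eq_square) algebra
        then show ?thesis using \<open>0 < \<mu>\<close> by (simp add: distrib_left)
      qed
      ultimately show ?thesis
        by (simp only: sc mult_1_right) (simp add: power2_eq_square)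
    qed
    have \<phi>mono: "\<phi> u \<le> \<phi> t" if "\<alpha> < t" "t \<le> u" for t
    proof (rule DERIV_nonpos_imp_nonincreasing[OF \<open>t \<le> u\<close>])
      fix x assume "t \<le> x" "x \<le> u"
      then have x: "x \<in> {\<alpha><..<\<beta>}" using that u by auto
      have "W x + K \<le> 0" using Wmono[of x u] x u \<open>x \<le> u\<close> by (auto simp: K_def)
      then have "(W x + K) / (s x)\<^sup>2 \<le> 0" by (simp add: divide_nonpos_nonneg)
      then show "\<exists>y. (\<phi> has_real_derivative y) (at x) \<and> y \<le> 0" using \<phi>'[OF x] by blast
    qed
    have "eventually (\<lambda>t. \<phi> u * s t \<le> w t - (K / \<mu>) * c t) (at_right \<alpha>)"
    proof -
      have "eventually (\<lambda>t. t \<in> {\<alpha><..<u}) (at_right \<alpha>)"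
        using u by (intro eventually_at_right_real) auto
      then show ?thesis
      proof eventually_elim
        case (elim t)
        then have "s t > 0" using spos[of t] u by auto
        have "\<phi> u * s t \<le> \<phi> t * s t" using \<phi>mono[of t] elim \<open>s t > 0\<close> by auto
        also have "\<dots> = w t - (K / \<mu>) * c t" using \<open>s t > 0\<close> \<open>0 < \<mu>\<close>
          by (simp add: \<phi>_def field_simps)
        finally show ?case .
      qed
    qed
    moreover have "((\<lambda>t. \<phi> u * s t) \<longlongrightarrow> \<phi> u * s \<alpha>) (at_right \<alpha>)"
      unfolding s_def by (intro tendsto_intros)
    moreover have "((\<lambda>t. w t - (K / \<mu>) * c t) \<longlongrightarrow> 0 - (K / \<mu>) * c \<alpha>) (at_right \<alpha>)"
      unfolding c_def by (intro tendsto_intros cont_at)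
    ultimately have "\<phi> u * s \<alpha> \<le> 0 - (K / \<mu>) * c \<alpha>"
      by (intro tendsto_le[OF trivial_limit_at_right_real])
    then have "K / \<mu> \<le> 0" by (simp add: s_def c_def)
    then show False using \<open>K > 0\<close> \<open>0 < \<mu>\<close> by (simp add: divide_le_0_iff)
  qed
  define u where "u = (\<alpha> + \<beta>) / 2"
  have u: "u \<in> {\<alpha><..<\<beta>}" using \<open>\<alpha> < \<beta>\<close> by (auto simp: u_def)
  have r': "((\<lambda>t. w t / s t) has_real_derivative W t / (s t)\<^sup>2) (at t)" if "t \<in> {\<alpha><..<\<beta>}" for t
    unfolding W_def using spos[of t] that
    by (auto intro!: derivative_eq_intros w'[OF that] s' simp: power2_eq_square)
  have scont: "continuous_on {u..\<beta>} s" unfolding s_def by (intro continuous_intros)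
  have "w u / s u \<le> w \<beta> / s \<beta>"
  proof (rule DERIV_nonneg_imp_increasing_open[where f = "\<lambda>t. w t / s t"])
    show "u \<le> \<beta>" using u by auto
    fix x assume "u < x" "x < \<beta>"
    then have x: "x \<in> {\<alpha><..<\<beta>}" using u by auto
    have "0 \<le> W x / (s x)\<^sup>2" using Wpos[OF x] by simp
    then show "\<exists>y. ((\<lambda>t. w t / s t) has_real_derivative y) (at x) \<and> 0 \<le> y"
      using r'[OF x] by blast
  next
    have "continuous_on {u..\<beta>} w"
      using cont by (rule continuous_on_subset) (use u in auto)
    moreover have "\<forall>x\<in>{u..\<beta>}. s x \<noteq> 0"
    proof
      fix x assume "x \<in> {u..\<beta>}"
      then show "s x \<noteq> 0" using spos[of x] u by auto
    qed
    ultimately show "continuous_on {u..\<beta>} (\<lambda>t. w t / s t)"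
      using scont by (intro continuous_on_divide)
  qed
  moreover have "w u / s u > 0" using pos[OF u] spos[of u] u by auto
  ultimately have "w \<beta> / s \<beta> > 0" by linarith
  moreover have "s \<beta> > 0" using spos[of \<beta>] \<open>\<alpha> < \<beta>\<close> by simp
  ultimately show ?thesis by (simp add: zero_less_divide_iff)
qed

text \<open>
  The comparison is applied on a maximal interval without zeros, so it does not matter how the
  zeros of \<open>n\<close> accumulate.
\<close>
lemma zero_free_gap:
  fixes n :: "real \<Rightarrow> real"
  assumes "continuous_on {a..b} n" "n a = 0" "n b = 0" "c \<in> {a..b}" "n c \<noteq> 0"
  obtains \<alpha> \<beta> where "a \<le> \<alpha>" "\<alpha> < \<beta>" "\<beta> \<le> b" "n \<alpha> = 0" "n \<beta> = 0"
    "\<And>t. t \<in> {\<alpha><..<\<beta>} \<Longrightarrow> n t \<noteq> 0"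
proof -
  define L where "L = {t \<in> {a..c}. n t = 0}"
  define R where "R = {t \<in> {c..b}. n t = 0}"
  have cL: "continuous_on {a..c} n" and cR: "continuous_on {c..b} n"
    using assms(1,4) by (auto intro: continuous_on_subset)
  have "closed L" unfolding L_def
    by (rule continuous_closed_preimage_constant[OF cL]) simp
  moreover have "bounded L"
    by (rule bounded_subset[OF bounded_closed_interval[of a c]]) (auto simp: L_def)
  ultimately have L: "compact L" by (simp add: compact_eq_bounded_closed)
  have "closed R" unfolding R_def
    by (rule continuous_closed_preimage_constant[OF cR]) simp
  moreover have "bounded R"
    by (rule bounded_subset[OF bounded_closed_interval[of c b]]) (auto simp: R_def)
  ultimately have R: "compact R" by (simp add: compact_eq_bounded_closed)
  have "a \<in> L" "b \<in> R" using assms by (auto simp: L_def R_def)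
  then obtain \<alpha> \<beta> where \<alpha>: "\<alpha> \<in> L" "\<And>t. t \<in> L \<Longrightarrow> t \<le> \<alpha>" and \<beta>: "\<beta> \<in> R" "\<And>t. t \<in> R \<Longrightarrow> \<beta> \<le> t"
    using compact_attains_sup[OF L] compact_attains_inf[OF R] by (metis empty_iff)
  have "\<alpha> \<noteq> c" "\<beta> \<noteq> c" using \<alpha>(1) \<beta>(1) assms(5) by (auto simp: L_def R_def)
  moreover have "n t \<noteq> 0" if "t \<in> {\<alpha><..<\<beta>}" for t
  proof
    assume "n t = 0"
    then have "t \<in> L \<or> t \<in> R" using that \<alpha>(1) \<beta>(1) by (auto simp: L_def R_def)
    then show False using \<alpha>(2) \<beta>(2) that by force
  qed
  ultimately show thesis using \<alpha>(1) \<beta>(1) by (intro that[of \<alpha> \<beta>]) (auto simp: L_def R_def)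
qed

section \<open>The pointwise inequality\<close>

text \<open>
  Here \<open>X\<close> and \<open>Y\<close> stand for the horizontal part \<open>U + i V\<close> and the height \<open>W\<close> of a point \<open>F\<close> in space, and
  the surface has the conformal factor \<open>E = |a|\<^sup>2 + |b|\<^sup>2\<close>. Then \<open>S / E\<close> is the component of \<open>F\<close> along the
  unit normal, and \<open>Nz\<close> is the derivative \<open>2 \<langle>F, F\<^sub>z\<rangle>\<close> of \<open>N = |F|\<^sup>2\<close>. The first identity is Pythagoras'
  theorem, as \<open>|Nz|\<^sup>2\<close> is \<open>E\<^sup>2\<close> times the squared tangential part of \<open>F\<close>. In the second,
  \<open>Nzz - 2 \<sigma>\<^sub>z Nz\<close> is a covariant derivative, so it sees only the second fundamental form
  \<open>\<i> (a' b - a b')\<close> and the normal component of \<open>F\<close>.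
\<close>
lemma spinor_identities:
  fixes a b a' b' X :: complex and Y :: real
  defines "E \<equiv> a * cnj a + b * cnj b"
    and "S \<equiv> (a * cnj a - b * cnj b) * Y + (a * cnj b * cnj X - cnj a * b * X) / \<i>"
    and "Nz \<equiv> a\<^sup>2 * cnj X + b\<^sup>2 * X - 2 * \<i> * a * b * Y"
    and "Nzz \<equiv> 2 * a * a' * cnj X + 2 * b * b' * X - 2 * \<i> * (a' * b + a * b') * Y"
  shows "E\<^sup>2 * (X * cnj X + (complex_of_real Y)\<^sup>2) - Nz * cnj Nz = S\<^sup>2"
    and "Nzz * E - 2 * Nz * (a' * cnj a + b' * cnj b) = 2 * \<i> * (a' * b - a * b') * S"
proof -
  have i: "x / \<i> = - (\<i> * x)" "\<i> * (\<i> * x) = - x"  for x :: complex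
    by (simp_all add: field_simps) 
  have i2: "\<i> * \<i> = - 1" by simp
  show "E\<^sup>2 * (X * cnj X + (complex_of_real Y)\<^sup>2) - Nz * cnj Nz = S\<^sup>2"
    unfolding E_def S_def Nz_def i(1) complex_cnj_mult complex_cnj_add complex_cnj_diff
      complex_cnj_power complex_cnj_cnj complex_cnj_complex_of_real complex_cnj_i complex_cnj_numeral
    using i2 by algebra
  show "Nzz * E - 2 * Nz * (a' * cnj a + b' * cnj b) = 2 * \<i> * (a' * b - a * b') * S"
    unfolding E_def S_def Nz_def Nzz_def i(1)
    using i2 by algebra
qed

text \<open>
  Here \<open>Q = 2 \<partial>\<^sub>z log w\<close> for \<open>w = |F| e\<^bsup>(\<rho> - \<sigma>)/2\<^esup>\<close>, and \<open>Qz\<close>, \<open>Qzb\<close> are the two Wirtinger derivatives of \<open>Q\<close>. Along a geodesic with velocity \<open>v\<close> and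
  acceleration \<open>- 2 \<rho>\<^sub>z v\<^sup>2\<close> the left-hand side of the conclusion is \<open>(log w)'' + ((log w)')\<^sup>2 = w'' / w\<close>.

  In it, the terms in \<open>Q\<close> combine to \<open>(Re (Q v))\<^sup>2 - Re ((Q v)\<^sup>2) = (Im (Q v))\<^sup>2 \<ge> 0\<close>. Besides the
  difference of the Schwarzians and \<open>rzb\<close>, what is left is \<open>2 \<i> \<omega> S / (E N)\<close>, from the second fundamental form, and
  \<open>S\<^sup>2 / N\<^sup>2 - |\<omega>|\<^sup>2 / E\<^sup>2\<close>. By \<open>2 x y \<le> x\<^sup>2 + y\<^sup>2\<close> the normal component \<open>S\<close> of \<open>F\<close> drops out, at a total
  loss of \<open>2 |\<omega>|\<^sup>2 / E\<^sup>2\<close>, half of \<open>e\<^bsup>2\<sigma>\<^esup> |K|\<close>.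
\<close>
lemma riccati_bound:
  fixes a b a' b' X v szz rz rzz rzb :: complex and Y M :: real
  defines "E \<equiv> a * cnj a + b * cnj b" and "N \<equiv> X * cnj X + (complex_of_real Y)\<^sup>2"
    and "\<omega> \<equiv> a' * b - a * b'" 
    and "Nz \<equiv> a\<^sup>2 * cnj X + b\<^sup>2 * X - 2 * \<i> * a * b * Y"
    and "Nzz \<equiv> 2 * a * a' * cnj X + 2 * b * b' * X - 2 * \<i> * (a' * b + a * b') * Y"
  defines "sz \<equiv> (a' * cnj a + b' * cnj b) / E"
  defines "Q \<equiv> Nz / N + rz - sz"
    and "Qz \<equiv> Nzz / N - Nz\<^sup>2 / N\<^sup>2 + rzz - szz"
    and "Qzb \<equiv> E\<^sup>2 / N - Nz * cnj Nz / N\<^sup>2 + rzb - \<omega> * cnj \<omega> / E\<^sup>2"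
  assumes "E \<noteq> 0" "N \<noteq> 0"
    and bound: "norm (2 * (szz - sz\<^sup>2) - 2 * (rzz - rz\<^sup>2)) + 4 * (norm \<omega> / norm E)\<^sup>2
                  \<le> 2 * M + 2 * Re rzb"
  shows "Re ((Qz * v + Qzb * cnj v) * v + Q * (- 2 * rz * v\<^sup>2)) + (Re (Q * v))\<^sup>2
           \<ge> - (M * (norm v)\<^sup>2)"
proof -
  define S where "S = (a * cnj a - b * cnj b) * Y + (a * cnj b * cnj X - cnj a * b * X) / \<i>"
  note H = spinor_identities(1)[of a b X Y, folded E_def N_def Nz_def S_def]
    spinor_identities(2)[of a a' X b b' Y, folded E_def Nz_def Nzz_def S_def \<omega>_def]
  have Sr: "cnj S = S" unfolding S_def by (simp add: field_simps)
  have Er: "cnj E = E" unfolding E_def by (simp add: mult.commute)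
  have Nr: "cnj N = N" unfolding N_def by (simp add: mult.commute)
  define B where "B = 2 * \<i> * \<omega> * S / (E * N)"
  define A where "A = 2 * (szz - sz\<^sup>2) - 2 * (rzz - rz\<^sup>2)"
  have "(Nzz - 2 * Nz * sz) / N = B"
  proof -
    have "Nzz - 2 * Nz * sz = (Nzz * E - 2 * Nz * (a' * cnj a + b' * cnj b)) / E"
      unfolding sz_def using \<open>E \<noteq> 0\<close> by (simp add: diff_divide_distrib)
    then show ?thesis unfolding H(2) B_def by simp
  qed
  moreover have "Qz - 2 * rz * Q = - A / 2 + (Nzz - 2 * Nz * sz) / N - Q\<^sup>2"
  proof -
    have A2: "- A / 2 = (rzz - rz\<^sup>2) - (szz - sz\<^sup>2)"
      unfolding A_def by simp
    have "n * i - (m * i)\<^sup>2 + rzz - szz - 2 * rz * (m * i + rz - sz)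
        = (rzz - rz\<^sup>2) - (szz - sz\<^sup>2) + (n - 2 * m * sz) * i - (m * i + rz - sz)\<^sup>2"
      for n m i by algebra
    from this[of Nzz "inverse N" Nz] show ?thesis
      unfolding Qz_def Q_def A2 by (simp only: divide_inverse power_mult_distrib power_inverse)
  qed
  ultimately have "Qz - 2 * rz * Q = - A / 2 + B - Q\<^sup>2" by simp
  moreover have "(Qz * v + Qzb * cnj v) * v + Q * (- 2 * rz * v\<^sup>2)
      = (Qz - 2 * rz * Q) * v\<^sup>2 + Qzb * (v * cnj v)"
    by (simp add: algebra_simps power2_eq_square)
  ultimately have 1: "(Qz * v + Qzb * cnj v) * v + Q * (- 2 * rz * v\<^sup>2)
      = (- A / 2 + B) * v\<^sup>2 - (Q * v)\<^sup>2 + Qzb * (v * cnj v)"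
    by (simp add: left_diff_distrib power_mult_distrib)
  have "Qzb = (S / N)\<^sup>2 + rzb - (norm \<omega> / norm E)\<^sup>2"
  proof -
    have "\<omega> * cnj \<omega> / (E * cnj E) = (norm \<omega> / norm E)\<^sup>2"
      by (simp add: power_divide flip: complex_norm_square)
    then have "\<omega> * cnj \<omega> / E\<^sup>2 = (norm \<omega> / norm E)\<^sup>2"
      unfolding Er by (simp add: power2_eq_square)
    moreover have "E\<^sup>2 / N - Nz * cnj Nz / N\<^sup>2 = (S / N)\<^sup>2"
    proof -
      have "E\<^sup>2 / N - Nz * cnj Nz / N\<^sup>2 = (E\<^sup>2 * N - Nz * cnj Nz) / N\<^sup>2"
        using \<open>N \<noteq> 0\<close> by (simp add: diff_divide_distrib power2_eq_square)
      then show ?thesis unfolding H(1) by (simp add: power_divide)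
    qed
    ultimately show ?thesis unfolding Qzb_def by simp
  qed
  moreover have "(S / N)\<^sup>2 = (norm S / norm N)\<^sup>2"
  proof -
    have "S * cnj S / (N * cnj N) = (norm S / norm N)\<^sup>2"
      by (simp add: power_divide flip: complex_norm_square)
    then show ?thesis
      unfolding Sr Nr by (simp add: power2_eq_square)
  qed
  ultimately have "Re Qzb = (norm S / norm N)\<^sup>2 + Re rzb - (norm \<omega> / norm E)\<^sup>2"
    by simp
  then have 2: "Re (Qzb * (v * cnj v)) =
      ((norm S / norm N)\<^sup>2 + Re rzb - (norm \<omega> / norm E)\<^sup>2) * (norm v)\<^sup>2"
    by (simp flip: complex_norm_square of_real_power)
  have 3: "(Re (Q * v))\<^sup>2 - Re ((Q * v)\<^sup>2) \<ge> 0"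
    by (simp add: power2_eq_square)
  have "norm B = 2 * (norm \<omega> / norm E) * (norm S / norm N)"
    unfolding B_def by (simp add: norm_mult norm_divide)
  also have "\<dots> \<le> (norm \<omega> / norm E)\<^sup>2 + (norm S / norm N)\<^sup>2"
    by (rule sum_squares_bound)
  finally have "norm B \<le> (norm \<omega> / norm E)\<^sup>2 + (norm S / norm N)\<^sup>2" .
  moreover have "norm (- A / 2 + B) \<le> norm A / 2 + norm B"
    using norm_triangle_ineq[of "- A / 2" B] by (simp add: norm_divide)
  moreover have "norm A + 4 * (norm \<omega> / norm E)\<^sup>2 \<le> 2 * M + 2 * Re rzb"
    using bound unfolding A_def .
  ultimately have "norm (- A / 2 + B)
      \<le> M + Re rzb - (norm \<omega> / norm E)\<^sup>2 + (norm S / norm N)\<^sup>2"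
    by linarith
  from mult_right_mono[OF this, of "(norm v)\<^sup>2"]
  have "norm (- A / 2 + B) * (norm v)\<^sup>2 \<le> M * (norm v)\<^sup>2 + Re (Qzb * (v * cnj v))"
    unfolding 2 by (simp only: distrib_right left_diff_distrib zero_le_power2 simp_thms)
       (simp add: algebra_simps)
  moreover have "Re ((- A / 2 + B) * v\<^sup>2) \<ge> - (norm (- A / 2 + B) * (norm v)\<^sup>2)"
    using abs_Re_le_cmod[of "(- A / 2 + B) * v\<^sup>2"]
    unfolding norm_mult norm_power by linarith
  ultimately show ?thesis
    unfolding 1 plus_complex.sel(1) minus_complex.sel(1) using 3 by linarith
qed

section \<open>The Weierstrass data of the lift\<close>

text \<open>
  A meromorphic function has no poles where its square is bounded.
\<close>
lemma meromorphic_square_removable: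
  assumes "p meromorphic_on U" "open U" "F holomorphic_on U"
    and sq: "\<forall>\<^sub>\<approx>z\<in>U. (p z)\<^sup>2 = F z"
  shows "remove_sings p holomorphic_on U" "\<And>z. z \<in> U \<Longrightarrow> (remove_sings p z)\<^sup>2 = F z"
proof -
  have mero: "p meromorphic_on {z}" if "z \<in> U" for z
    using assms(1) that by (simp add: meromorphic_on_subset)
  have tendsto: "\<exists>c. p \<midarrow>z\<rightarrow> c" if "z \<in> U" for z
  proof -
    have F: "F \<midarrow>z\<rightarrow> F z"
      using \<open>F holomorphic_on U\<close> \<open>open U\<close> that holomorphic_on_imp_continuous_on
      by (metis continuous_on_eq_continuous_at isCont_def)
    have "eventually (\<lambda>w. (p w)\<^sup>2 = F w) (at z)"
      using sq that by (rule eventually_cosparse_imp_eventually_at)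
    with F have p2: "((\<lambda>w. (p w)\<^sup>2) \<longlongrightarrow> F z) (at z)"
      by (simp add: tendsto_cong)
    have "\<not> is_pole p z"
    proof
      assume "is_pole p z"
      then have "is_pole (\<lambda>w. (p w)\<^sup>2) z"
        unfolding is_pole_def
        using Limits.filterlim_power_at_infinity[where f = p and F = "at z" and n = 2] by simp
      with p2 show False
        unfolding is_pole_def by (intro not_tendsto_and_filterlim_at_infinity[OF trivial_limit_at])
    qed
    moreover have "not_essential p z"
      using mero[OF that] by (rule meromorphic_on_not_essential)
    ultimately show ?thesis unfolding not_essential_def by blast
  qed
  have "remove_sings p analytic_on {z}" if "z \<in> U" for z
    using tendsto[OF that] meromorphic_on_isolated_singularity[OF mero[OF that]]
    by (auto intro: remove_sings_analytic_at)
  then have ana: "remove_sings p analytic_on U" using analytic_on_analytic_at by blast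
  then show hol: "remove_sings p holomorphic_on U" by (rule analytic_imp_holomorphic)
  show "(remove_sings p z)\<^sup>2 = F z" if "z \<in> U" for z
  proof -
    have "eventually (\<lambda>w. (remove_sings p w)\<^sup>2 = F w) (cosparse U)"
      using eventually_remove_sings_eq[OF assms(1)] sq by eventually_elim simp
    then have ev: "eventually (\<lambda>w. (remove_sings p w)\<^sup>2 = F w) (at z)"
      using that by (rule eventually_cosparse_imp_eventually_at)
    have "F \<midarrow>z\<rightarrow> F z" and r: "remove_sings p \<midarrow>z\<rightarrow> remove_sings p z"
      using \<open>F holomorphic_on U\<close> hol \<open>open U\<close> that holomorphic_on_imp_continuous_on
      by (metis continuous_on_eq_continuous_at isCont_def)+
    moreover have "(\<lambda>w. (remove_sings p w)\<^sup>2) \<midarrow>z\<rightarrow> (remove_sings p z)\<^sup>2"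
      using r by (intro tendsto_intros)
    ultimately show ?thesis
      using tendsto_cong[OF ev] tendsto_unique[OF trivial_limit_at] by blast
  qed
qed

lemma contour_integral_linepath_cosparse_eq:
  assumes "\<forall>\<^sub>\<approx>z\<in>U. F z = G z" "closed_segment a b \<subseteq> U"
  shows "contour_integral (linepath a b) F = contour_integral (linepath a b) G"
proof (cases "a = b")
  case False
  define B where "B = closed_segment a b \<inter> {z. F z \<noteq> G z}"
  have "finite B" unfolding B_def
    using assms sparse_in_subset
    by (intro sparse_in_compact_finite) (auto simp: eventually_cosparse)
  then show ?thesis
    using False by (intro contour_integral_spike_finite_simple_path[where A = B]) (auto simp: B_def)
qed simp

text \<open>
  Replacing \<open>h' q\<close> by its holomorphic extension \<open>k\<close> turns the third coordinate of the lift into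
  \<open>2 Im P\<close> up to a constant, so the base point \<open>z\<^sub>0\<close> and the values of \<open>q\<close> disappear from the problem.
\<close>
lemma third_coordinate_primitive:
  assumes "h holomorphic_on \<bbbD>" "g holomorphic_on \<bbbD>" "dilatation_is_square h g q"
  obtains P k where "\<And>z. z \<in> \<bbbD> \<Longrightarrow> (P has_field_derivative k z) (at z)"
    "\<And>z. z \<in> \<bbbD> \<Longrightarrow> (k z)\<^sup>2 = deriv h z * deriv g z"
    "\<And>a z. a \<in> \<bbbD> \<Longrightarrow> z \<in> \<bbbD> \<Longrightarrow>
       contour_integral (linepath a z) (\<lambda>\<zeta>. deriv h \<zeta> * q \<zeta>) = P z - P a"
proof -
  define p where "p z = deriv h z * q z" for z
  define k where "k = remove_sings p"
  have hol': "deriv h holomorphic_on \<bbbD>" "deriv g holomorphic_on \<bbbD>"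
    using assms by (auto intro!: holomorphic_deriv)
  have q: "q meromorphic_on \<bbbD>"
    and dil: "\<forall>\<^sub>\<approx>z\<in>\<bbbD>. deriv h z \<noteq> 0 \<and> deriv g z / deriv h z = (q z)\<^sup>2"
    using assms(3) by (auto simp: dilatation_is_square_def)
  have mero: "p meromorphic_on \<bbbD>"
    unfolding p_def using hol'(1) q
    by (intro meromorphic_on_mult[OF analytic_on_imp_meromorphic_on]) (simp_all add: analytic_on_open)
  have sq: "\<forall>\<^sub>\<approx>z\<in>\<bbbD>. (p z)\<^sup>2 = deriv h z * deriv g z"
    using dil by eventually_elim (auto simp: p_def power_mult_distrib power2_eq_square field_simps)
  have k: "k holomorphic_on \<bbbD>" "\<And>z. z \<in> \<bbbD> \<Longrightarrow> (k z)\<^sup>2 = deriv h z * deriv g z"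
    unfolding k_def
    using meromorphic_square_removable[OF mero _ _ sq] hol' by (auto intro!: holomorphic_on_mult)
  obtain P where P: "\<And>z. z \<in> \<bbbD> \<Longrightarrow> (P has_field_derivative k z) (at z within \<bbbD>)"
    using holomorphic_convex_primitive'[OF convex_ball open_ball k(1)] by metis
  have int: "contour_integral (linepath a z) (\<lambda>\<zeta>. deriv h \<zeta> * q \<zeta>) = P z - P a"
    if "a \<in> \<bbbD>" "z \<in> \<bbbD>" for a z
  proof -
    have seg: "closed_segment a z \<subseteq> \<bbbD>" using that by (simp add: closed_segment_subset)
    have "contour_integral (linepath a z) p = contour_integral (linepath a z) k"
      using eventually_remove_sings_eq[OF mero] seg
      by (intro contour_integral_linepath_cosparse_eq[where U = \<bbbD>]) (auto simp: k_def eq_commute)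
    also have "\<dots> = P z - P a"
      using contour_integral_primitive[OF P, of "linepath a z"] seg
      by (intro contour_integral_unique) auto
    finally show ?thesis unfolding p_def .
  qed
  have "(P has_field_derivative k z) (at z)" if "z \<in> \<bbbD>" for z
    using P[OF that] at_within_open[OF that open_ball] by simp
  from that[OF this k(2) int] show thesis .
qed

locale weierstrass_data =
  fixes h g k P :: "complex \<Rightarrow> complex"
  assumes holomorphic: "h holomorphic_on \<bbbD>" "g holomorphic_on \<bbbD>"
    and primitive: "\<And>z. z \<in> \<bbbD> \<Longrightarrow> (P has_field_derivative k z) (at z)"
    and square: "\<And>z. z \<in> \<bbbD> \<Longrightarrow> (k z)\<^sup>2 = deriv h z * deriv g z"
    and immersed: "\<And>z. z \<in> \<bbbD> \<Longrightarrow> deriv h z \<noteq> 0 \<or> deriv g z \<noteq> 0"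
begin

lemma deriv_holomorphic: "deriv h holomorphic_on \<bbbD>" "deriv g holomorphic_on \<bbbD>" "k holomorphic_on \<bbbD>"
proof -
  show "deriv h holomorphic_on \<bbbD>" "deriv g holomorphic_on \<bbbD>"
    using holomorphic by (auto intro!: holomorphic_deriv)
  have P: "P holomorphic_on \<bbbD>"
    using primitive by (meson field_differentiable_at_within field_differentiable_def holomorphic_onI)
  show "k holomorphic_on \<bbbD>"
    by (rule holomorphic_transform[OF holomorphic_deriv[OF P open_ball]])
      (use primitive DERIV_imp_deriv in blast)
qed

text \<open>
  Since \<open>h'\<close> and \<open>g'\<close> have no common zero, one of them has a holomorphic square root near any
  given point; dividing \<open>k\<close> by it gives the square root of the other one, zeros included. This is the
  spinor representation of the minimal surface.
\<close>
lemma local_spinors: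
  assumes "z \<in> \<bbbD>"
  obtains U a b where "open U" "z \<in> U" "U \<subseteq> \<bbbD>" "a holomorphic_on U" "b holomorphic_on U"
    "\<And>w. w \<in> U \<Longrightarrow> deriv h w = (a w)\<^sup>2" "\<And>w. w \<in> U \<Longrightarrow> deriv g w = (b w)\<^sup>2"
    "\<And>w. w \<in> U \<Longrightarrow> k w = a w * b w" "\<And>w. w \<in> U \<Longrightarrow> a w \<noteq> 0 \<or> b w \<noteq> 0"
proof -
  have root: "\<exists>r s. r > 0 \<and> ball z r \<subseteq> \<bbbD> \<and> s holomorphic_on ball z r \<and>
      (\<forall>w\<in>ball z r. F w = (s w)\<^sup>2 \<and> s w \<noteq> 0)"
    if F: "F holomorphic_on \<bbbD>" "F z \<noteq> 0" for F
  proof -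
    have "open (F -` (- {0}) \<inter> \<bbbD>)"
      using holomorphic_on_imp_continuous_on[OF F(1)]
      by (metis Int_commute continuous_open_preimage open_Compl closed_singleton open_ball finite.intros)
    then obtain r where r: "r > 0" "ball z r \<subseteq> F -` (- {0}) \<inter> \<bbbD>"
      using F(2) assms by (metis ComplI IntI empty_iff insert_iff openE vimageI2)
    have "F holomorphic_on ball z r"
      using F(1) r(2) by (meson holomorphic_on_subset Int_subset_iff)
    then obtain s where s: "s holomorphic_on ball z r" "\<And>w. w \<in> ball z r \<Longrightarrow> F w = (s w)\<^sup>2"
      using contractible_imp_holomorphic_sqrt[of F "ball z r"] r(2) convex_imp_contractible[OF convex_ball]
      by blast
    have "s w \<noteq> 0" if "w \<in> ball z r" for w using r(2) s(2)[OF that] that by auto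
    then show ?thesis using r s by blast
  qed
  consider "deriv h z \<noteq> 0" | "deriv g z \<noteq> 0" using immersed[OF assms] by blast
  then show thesis
  proof cases
    case 1
    from root[OF deriv_holomorphic(1) this] obtain r a where r: "r > 0" "ball z r \<subseteq> \<bbbD>"
      "a holomorphic_on ball z r" and a: "\<And>w. w \<in> ball z r \<Longrightarrow> deriv h w = (a w)\<^sup>2 \<and> a w \<noteq> 0"
      by blast
    have "(k w / a w)\<^sup>2 = deriv g w" if "w \<in> ball z r" for w
      using a[OF that] square[of w] that r(2) by (auto simp: power_divide)
    then show thesis using r a
      by (intro that[of "ball z r" a "\<lambda>w. k w / a w"])
        (auto intro!: holomorphic_on_divide holomorphic_on_subset[OF deriv_holomorphic(3)])
  next
    case 2
    from root[OF deriv_holomorphic(2) this] obtain r b where r: "r > 0" "ball z r \<subseteq> \<bbbD>"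
      "b holomorphic_on ball z r" and b: "\<And>w. w \<in> ball z r \<Longrightarrow> deriv g w = (b w)\<^sup>2 \<and> b w \<noteq> 0"
      by blast
    have "(k w / b w)\<^sup>2 = deriv h w" if "w \<in> ball z r" for w
      using b[OF that] square[of w] that r(2) by (auto simp: power_divide)
    then show thesis using r b
      by (intro that[of "ball z r" "\<lambda>w. k w / b w" b])
        (auto intro!: holomorphic_on_divide holomorphic_on_subset[OF deriv_holomorphic(3)])
  qed
qed

abbreviation log_factor\<^sub>c :: "complex \<Rightarrow> complex"
  where "log_factor\<^sub>c w \<equiv> complex_of_real (log_factor h g w)"

text \<open>
  Here \<open>\<sigma> = log (|a|\<^sup>2 + |b|\<^sup>2)\<close>, and the mixed derivative collapses to \<open>|a' b - a b'|\<^sup>2 / E\<^sup>2\<close> by Lagrange's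
  identity.
\<close>
lemma log_factor_derivatives:
  assumes U: "open U" "z \<in> U" "a holomorphic_on U" "b holomorphic_on U"
    and ha: "\<And>w. w \<in> U \<Longrightarrow> deriv h w = (a w)\<^sup>2" and gb: "\<And>w. w \<in> U \<Longrightarrow> deriv g w = (b w)\<^sup>2"
    and nz: "\<And>w. w \<in> U \<Longrightarrow> a w \<noteq> 0 \<or> b w \<noteq> 0"
  defines "E \<equiv> a z * cnj (a z) + b z * cnj (b z)"
    and "\<omega> \<equiv> deriv a z * b z - a z * deriv b z"
  shows "wirtinger log_factor\<^sub>c z = (deriv a z * cnj (a z) + deriv b z * cnj (b z)) / E"
    and "has_wirtinger log_factor\<^sub>c (wirtinger log_factor\<^sub>c z) (cnj (wirtinger log_factor\<^sub>c z)) z"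
    and "has_wirtinger (wirtinger log_factor\<^sub>c) (wirtinger (wirtinger log_factor\<^sub>c) z)
           (\<omega> * cnj \<omega> / E\<^sup>2) z"
    and "laplacian (log_factor h g) z = 4 * (norm \<omega> / norm E)\<^sup>2"
proof -
  define e where "e w = (norm (a w))\<^sup>2 + (norm (b w))\<^sup>2" for w
  define D where "D w = deriv a w * cnj (a w) + deriv b w * cnj (b w)" for w
  have ec: "complex_of_real (e w) = a w * cnj (a w) + b w * cnj (b w)" for w
    by (simp add: e_def flip: complex_norm_square)
  have epos: "e w > 0" if "w \<in> U" for w
    using nz[OF that] by (auto simp: e_def intro: add_pos_nonneg add_nonneg_pos)
  have ab: "has_wirtinger a (deriv a w) 0 w" "has_wirtinger b (deriv b w) 0 w"
    and ab': "has_wirtinger (deriv a) (deriv (deriv a) w) 0 w"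
      "has_wirtinger (deriv b) (deriv (deriv b) w) 0 w" if "w \<in> U" for w
    using that U by (auto intro!: has_wirtinger_holomorphic holomorphic_derivI[where S = U] holomorphic_deriv)
  have e: "has_wirtinger (\<lambda>w. complex_of_real (e w)) (D w) (cnj (D w)) w" if "w \<in> U" for w
    unfolding ec
    using has_wirtinger_add[OF has_wirtinger_mult[OF ab(1) has_wirtinger_cnj[OF ab(1)]]
      has_wirtinger_mult[OF ab(2) has_wirtinger_cnj[OF ab(2)]], OF that that that that]
    by (simp add: D_def mult.commute)
  have L: "has_wirtinger log_factor\<^sub>c (D w / e w) (cnj (D w / e w)) w" if "w \<in> U" for w
    by (rule has_wirtinger_transform[OF has_wirtinger_ln[OF e epos, OF that that] U(1) that])
      (simp add: log_factor_def ha gb e_def norm_power)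
  note W = has_wirtinger_imp_eq(1)[OF L]
  have Ez: "E = complex_of_real (e z)" "E \<noteq> 0" using epos[OF U(2)] by (simp_all add: E_def flip: ec)
  show "wirtinger log_factor\<^sub>c z = (deriv a z * cnj (a z) + deriv b z * cnj (b z)) / E"
    unfolding W[OF U(2)] Ez(1) D_def ..
  show "has_wirtinger log_factor\<^sub>c (wirtinger log_factor\<^sub>c z) (cnj (wirtinger log_factor\<^sub>c z)) z"
    unfolding W[OF U(2)] by (rule L[OF U(2)])
  have D: "\<exists>p. has_wirtinger D p (deriv a z * cnj (deriv a z) + deriv b z * cnj (deriv b z)) z"
    unfolding D_def
    using has_wirtinger_add[OF has_wirtinger_mult[OF ab'(1) has_wirtinger_cnj[OF ab(1)]]
      has_wirtinger_mult[OF ab'(2) has_wirtinger_cnj[OF ab(2)]], OF U(2) U(2) U(2) U(2)]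
    by auto
  have alg: "(deriv a z * cnj (deriv a z) + deriv b z * cnj (deriv b z)) / E - D z * cnj (D z) / E\<^sup>2
      = \<omega> * cnj \<omega> / E\<^sup>2"
  proof -
    have "(deriv a z * cnj (deriv a z) + deriv b z * cnj (deriv b z)) * E - D z * cnj (D z) = \<omega> * cnj \<omega>"
      unfolding E_def D_def \<omega>_def by (simp add: algebra_simps)
    then show ?thesis using Ez(2)
      by (simp add: divide_simps power2_eq_square)
  qed
  obtain p where Q: "has_wirtinger (\<lambda>w. D w / e w) p (\<omega> * cnj \<omega> / E\<^sup>2) z"
    using D has_wirtinger_divide[OF _ e[OF U(2)]] Ez alg by (metis of_real_eq_0_iff)
  have "has_wirtinger (wirtinger log_factor\<^sub>c) p (\<omega> * cnj \<omega> / E\<^sup>2) z"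
    using Q by (rule has_wirtinger_transform[OF _ U(1,2)]) (simp add: W)
  then show "has_wirtinger (wirtinger log_factor\<^sub>c) (wirtinger (wirtinger log_factor\<^sub>c) z)
           (\<omega> * cnj \<omega> / E\<^sup>2) z"
    using has_wirtinger_imp_eq(1) by metis
  have "\<omega> * cnj \<omega> / E\<^sup>2 = complex_of_real ((norm \<omega> / norm E)\<^sup>2)"
    unfolding Ez(1) by (simp add: power_divide flip: complex_norm_square of_real_power)
  then have "Re (\<omega> * cnj \<omega> / E\<^sup>2) = (norm \<omega> / norm E)\<^sup>2" by simp
  then show "laplacian (log_factor h g) z = 4 * (norm \<omega> / norm E)\<^sup>2"
    using laplacian_eq_wirtinger[OF U(1,2) L Q] by simp
qed

text \<open>
  The difference of the points of the surface over \<open>w\<close> and over the base point \<open>A\<close>, split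
  into its first two coordinates and the third.
\<close>
definition plane_diff :: "complex \<Rightarrow> complex \<Rightarrow> complex"
  where "plane_diff A w = (h w - h A) + cnj (g w - g A)"

definition height_diff :: "complex \<Rightarrow> complex \<Rightarrow> real"
  where "height_diff A w = 2 * Im (P w - P A)"

definition sqdist :: "complex \<Rightarrow> complex \<Rightarrow> real"
  where "sqdist A w = (norm (plane_diff A w))\<^sup>2 + (height_diff A w)\<^sup>2"

text \<open>
  The Wirtinger derivative of the squared distance, see \<open>has_wirtinger_sqdist\<close>.
\<close>
definition sqdist_z :: "complex \<Rightarrow> complex \<Rightarrow> complex"
  where "sqdist_z A w = deriv h w * cnj (plane_diff A w) + deriv g w * plane_diff A w
    - 2 * \<i> * k w * height_diff A w"

lemma sqdist_complex:
  "complex_of_real (sqdist A w)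
     = plane_diff A w * cnj (plane_diff A w) + (complex_of_real (height_diff A w))\<^sup>2"
  by (simp add: sqdist_def flip: complex_norm_square)

lemma coordinate_derivatives:
  assumes "w \<in> \<bbbD>"
  shows "has_wirtinger (plane_diff A) (deriv h w) (cnj (deriv g w)) w"
    and "has_wirtinger (\<lambda>w. complex_of_real (height_diff A w)) (- \<i> * k w) (\<i> * cnj (k w)) w"
proof -
  have h: "has_wirtinger h (deriv h w) 0 w" and g: "has_wirtinger g (deriv g w) 0 w"
    and P: "has_wirtinger P (k w) 0 w"
    using assms holomorphic primitive
    by (auto intro!: has_wirtinger_holomorphic holomorphic_derivI[where S = \<bbbD>])
  note d = has_wirtinger_diff[OF _ has_wirtinger_const]
  show "has_wirtinger (plane_diff A) (deriv h w) (cnj (deriv g w)) w"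
    using has_wirtinger_add[OF d[OF h] has_wirtinger_cnj[OF d[OF g]], of "h A" "g A"]
    by (simp add: plane_diff_def[abs_def])
  have *: "complex_of_real (height_diff A w) = - \<i> * ((P w - P A) - cnj (P w - P A))" for w
    by (simp add: height_diff_def complex_eq_iff)
  show "has_wirtinger (\<lambda>w. complex_of_real (height_diff A w)) (- \<i> * k w) (\<i> * cnj (k w)) w"
    unfolding *
    using has_wirtinger_mult[OF has_wirtinger_const[of "- \<i>"]
        has_wirtinger_diff[OF d[OF P] has_wirtinger_cnj[OF d[OF P]]], of "P A" "P A"]
    by (simp only: mult_zero_left add_0_left diff_0_right complex_cnj_zero) simp
qed

lemma has_wirtinger_sqdist:
  assumes "w \<in> \<bbbD>"
  shows "has_wirtinger (\<lambda>w. complex_of_real (sqdist A w)) (sqdist_z A w) (cnj (sqdist_z A w)) w"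
proof -
  note X = coordinate_derivatives(1)[OF assms, of A] and Y = coordinate_derivatives(2)[OF assms, of A]
  have "deriv h w * cnj (plane_diff A w) + plane_diff A w * cnj (cnj (deriv g w))
      + (- \<i> * k w * height_diff A w + height_diff A w * (- \<i> * k w)) = sqdist_z A w"
    and "cnj (deriv g w) * cnj (plane_diff A w) + plane_diff A w * cnj (deriv h w)
      + (\<i> * cnj (k w) * height_diff A w + height_diff A w * (\<i> * cnj (k w))) = cnj (sqdist_z A w)"
    by (simp_all add: sqdist_z_def)
  with has_wirtinger_add[OF has_wirtinger_mult[OF X has_wirtinger_cnj[OF X]] has_wirtinger_mult[OF Y Y]]
  show ?thesis
    unfolding sqdist_complex power2_eq_square by simp
qed

text \<open>
  The part of the \<open>z\<close>-derivative that comes from differentiating the coordinates cancels, because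
  \<open>h' g' = k\<^sup>2\<close>: the surface is conformally parametrized.
\<close>
lemma has_wirtinger_sqdist_z:
  assumes U: "open U" "z \<in> U" "U \<subseteq> \<bbbD>" "a holomorphic_on U" "b holomorphic_on U"
    and ha: "\<And>w. w \<in> U \<Longrightarrow> deriv h w = (a w)\<^sup>2" and gb: "\<And>w. w \<in> U \<Longrightarrow> deriv g w = (b w)\<^sup>2"
    and kab: "\<And>w. w \<in> U \<Longrightarrow> k w = a w * b w"
  shows "has_wirtinger (sqdist_z A)
     (2 * a z * deriv a z * cnj (plane_diff A z) + 2 * b z * deriv b z * plane_diff A z
       - 2 * \<i> * (deriv a z * b z + a z * deriv b z) * height_diff A z)
     ((a z * cnj (a z) + b z * cnj (b z))\<^sup>2) z"
proof -
  have ab: "has_wirtinger a (deriv a z) 0 z" "has_wirtinger b (deriv b z) 0 z"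
    using U by (auto intro!: has_wirtinger_holomorphic holomorphic_derivI[where S = U])
  have z: "z \<in> \<bbbD>" using U by blast
  note X = coordinate_derivatives(1)[OF z, of A] and Y = coordinate_derivatives(2)[OF z, of A]
  note m = has_wirtinger_mult
  have "has_wirtinger (\<lambda>w. a w * a w * cnj (plane_diff A w) + b w * b w * plane_diff A w
        - (2 * \<i>) * (a w * b w) * height_diff A w)
     (2 * a z * deriv a z * cnj (plane_diff A z) + 2 * b z * deriv b z * plane_diff A z
       - 2 * \<i> * (deriv a z * b z + a z * deriv b z) * height_diff A z)
     ((a z * cnj (a z) + b z * cnj (b z))\<^sup>2) z"
    using has_wirtinger_diff[OF has_wirtinger_add[OF m[OF m[OF ab(1) ab(1)] has_wirtinger_cnj[OF X]]
          m[OF m[OF ab(2) ab(2)] X]] m[OF m[OF has_wirtinger_const[of "2 * \<i>"] m[OF ab]] Y]]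
    by (simp add: ha[OF U(2)] gb[OF U(2)] kab[OF U(2)] algebra_simps power2_eq_square)
  then show ?thesis
    by (rule has_wirtinger_transform[OF _ U(1,2)])
      (simp add: sqdist_z_def ha gb kab power2_eq_square algebra_simps)
qed

end

section \<open>Geodesics and the distance in space\<close>

text \<open>
  The geodesic equation makes \<open>e\<^bsup>2\<rho>\<^esup> |\<gamma>'|\<^sup>2\<close> constant, since the derivative of \<open>\<rho> \<circ> \<gamma>\<close> is
  \<open>2 Re (\<rho>\<^sub>z \<gamma>')\<close>. The parameter interval has length 1, so the constant speed is the length.
\<close>
lemma conformal_geodesic_constant_speed:
  assumes \<rho>: "smooth_on \<rho> \<bbbD>" and \<gamma>: "conformal_geodesic \<rho> \<gamma>"
  obtains \<gamma>' where "\<And>t. t \<in> {0..1} \<Longrightarrow> \<gamma> t \<in> \<bbbD>"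
    "\<And>t. t \<in> {0..1} \<Longrightarrow> (\<gamma> has_vector_derivative \<gamma>' t) (at t within {0..1})"
    "\<And>t. t \<in> {0..1} \<Longrightarrow> (\<gamma>' has_vector_derivative
        - 2 * wirtinger (\<lambda>w. complex_of_real (\<rho> w)) (\<gamma> t) * (\<gamma>' t)\<^sup>2) (at t within {0..1})"
    "\<And>t. t \<in> {0..1} \<Longrightarrow> exp (\<rho> (\<gamma> t)) * norm (\<gamma>' t) = conformal_length \<rho> \<gamma>"
proof -
  let ?I = "{0..1::real}"
  let ?r = "\<lambda>t. wirtinger (\<lambda>w. complex_of_real (\<rho> w)) (\<gamma> t)"
  obtain \<gamma>' where d: "\<And>t. t \<in> ?I \<Longrightarrow> (\<gamma> has_vector_derivative \<gamma>' t) (at t within ?I)"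
    and dd: "\<And>t. t \<in> ?I \<Longrightarrow> (\<gamma>' has_vector_derivative - 2 * ?r t * (\<gamma>' t)\<^sup>2) (at t within ?I)"
    using \<gamma> unfolding conformal_geodesic_def by blast
  have inD: "\<gamma> t \<in> \<bbbD>" if "t \<in> ?I" for t
    using \<gamma> that unfolding conformal_geodesic_def path_image_def by blast
  define e where "e t = exp (2 * \<rho> (\<gamma> t)) * ((Re (\<gamma>' t))\<^sup>2 + (Im (\<gamma>' t))\<^sup>2)" for t
  have "(e has_real_derivative 0) (at t within ?I)" if t: "t \<in> ?I" for t
  proof -
    have r: "((\<lambda>s. \<rho> (\<gamma> s)) has_real_derivative 2 * Re (?r t * \<gamma>' t)) (at t within ?I)"
      by (rule has_real_derivative_compose_wirtinger[OF
          smooth_on_has_wirtinger(1)[OF \<rho> open_ball inD[OF t]] d[OF t]])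
    let ?g = "- 2 * ?r t * (\<gamma>' t)\<^sup>2"
    have re: "((\<lambda>s. Re (\<gamma>' s)) has_real_derivative Re ?g) (at t within ?I)"
      and im: "((\<lambda>s. Im (\<gamma>' s)) has_real_derivative Im ?g) (at t within ?I)"
      unfolding has_real_derivative_iff_has_vector_derivative
      using dd[OF t] bounded_linear.has_vector_derivative[OF bounded_linear_Re]
        bounded_linear.has_vector_derivative[OF bounded_linear_Im] by blast+
    let ?E = "exp (2 * \<rho> (\<gamma> t))" and ?n = "(Re (\<gamma>' t))\<^sup>2 + (Im (\<gamma>' t))\<^sup>2"
    have "(e has_real_derivative ?E * (2 * (2 * Re (?r t * \<gamma>' t))) * ?n
        + ?E * (2 * (Re (\<gamma>' t) * Re ?g + Im (\<gamma>' t) * Im ?g))) (at t within ?I)"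
      unfolding e_def
      by (rule derivative_eq_intros r re im refl)+ (simp add: algebra_simps)
    moreover have "Re (\<gamma>' t) * Re ?g + Im (\<gamma>' t) * Im ?g = - (2 * Re (?r t * \<gamma>' t) * ?n)"
      by (simp add: power2_eq_square) algebra
    moreover have "x * (2 * (2 * y)) * n + x * (2 * (- (2 * y * n))) = 0" for x y n :: real
      by simp
    ultimately show ?thesis by (simp only:)
  qed
  then obtain C where C: "\<And>t. t \<in> ?I \<Longrightarrow> e t = C"
    using has_field_derivative_zero_constant[of ?I e] by auto
  have e: "e t = (exp (\<rho> (\<gamma> t)) * norm (\<gamma>' t))\<^sup>2" for t
    by (simp add: e_def power_mult_distrib cmod_power2 flip: exp_double)
  have speed: "exp (\<rho> (\<gamma> t)) * norm (\<gamma>' t) = sqrt C" if "t \<in> ?I" for t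
    using C[OF that] e[of t] by (simp add: real_sqrt_unique)
  have "conformal_length \<rho> \<gamma> = integral ?I (\<lambda>t. sqrt C)"
    unfolding conformal_length_def
  proof (rule integral_cong)
    fix t :: real assume t: "t \<in> ?I"
    have "vector_derivative \<gamma> (at t within ?I) = \<gamma>' t"
      using t d[OF t] by (intro vector_derivative_within_closed_interval[of 0 1]) auto
    then show "exp (\<rho> (\<gamma> t)) * norm (vector_derivative \<gamma> (at t within ?I)) = sqrt C"
      using speed[OF t] by simp
  qed
  then have "conformal_length \<rho> \<gamma> = sqrt C" by simp
  with that[OF inD d dd] speed show thesis by simp
qed

lemma conformal_geodesic_length_pos:
  assumes "smooth_on \<rho> \<bbbD>" "conformal_geodesic \<rho> \<gamma>" "\<gamma> 0 \<noteq> \<gamma> 1"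
  shows "conformal_length \<rho> \<gamma> > 0"
proof -
  obtain \<gamma>' where "\<And>t. t \<in> {0..1} \<Longrightarrow> \<gamma> t \<in> \<bbbD>"
    and d: "\<And>t. t \<in> {0..1} \<Longrightarrow> (\<gamma> has_vector_derivative \<gamma>' t) (at t within {0..1})"
    and "\<And>t. t \<in> {0..1} \<Longrightarrow> (\<gamma>' has_vector_derivative
        - 2 * wirtinger (\<lambda>w. complex_of_real (\<rho> w)) (\<gamma> t) * (\<gamma>' t)\<^sup>2) (at t within {0..1})"
    and speed: "\<And>t. t \<in> {0..1} \<Longrightarrow> exp (\<rho> (\<gamma> t)) * norm (\<gamma>' t) = conformal_length \<rho> \<gamma>"
    using conformal_geodesic_constant_speed[OF assms(1,2)] by blast
  have "conformal_length \<rho> \<gamma> \<noteq> 0"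
  proof
    assume "conformal_length \<rho> \<gamma> = 0"
    then have "\<gamma>' t = 0" if "t \<in> {0..1}" for t using speed[OF that] by simp
    with d have "(\<gamma> has_vector_derivative 0) (at t within {0..1})" if "t \<in> {0..1}" for t
      using that by metis
    then obtain C where "\<And>t. t \<in> {0..1} \<Longrightarrow> \<gamma> t = C"
      using has_vector_derivative_zero_constant[OF convex_real_interval(5)[of 0 1], of \<gamma>] by blast
    with assms(3) show False by simp
  qed
  moreover have "conformal_length \<rho> \<gamma> \<ge> 0"
    using mult_nonneg_nonneg[OF exp_ge_zero[of "\<rho> (\<gamma> 0)"] norm_ge_zero[of "\<gamma>' 0"]] speed[of 0] by simp
  ultimately show ?thesis by simp
qed

context weierstrass_data
begin

text \<open>
  This is \<open>2 \<partial>\<^sub>z log (weight A \<rho>)\<close>.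
\<close>
definition weight_log_z :: "complex \<Rightarrow> (complex \<Rightarrow> real) \<Rightarrow> complex \<Rightarrow> complex"
  where "weight_log_z A \<rho> w = sqdist_z A w / sqdist A w
    + wirtinger (\<lambda>w. complex_of_real (\<rho> w)) w - wirtinger log_factor\<^sub>c w"

text \<open>
  The function that is compared with a sine: the distance in space from the base point, normalized
  by the square root of the ratio of the conformal factors \<open>e\<^sup>\<rho>\<close> and \<open>e\<^sup>\<sigma>\<close>.
\<close>
definition weight :: "complex \<Rightarrow> (complex \<Rightarrow> real) \<Rightarrow> complex \<Rightarrow> real"
  where "weight A \<rho> w = sqrt (sqdist A w) * exp ((\<rho> w - log_factor h g w) / 2)"

lemma has_wirtinger_log_factor:
  assumes "z \<in> \<bbbD>"
  shows "has_wirtinger log_factor\<^sub>c (wirtinger log_factor\<^sub>c z) (cnj (wirtinger log_factor\<^sub>c z)) z"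
proof -
  obtain U a b where "open U" "z \<in> U" "U \<subseteq> \<bbbD>" "a holomorphic_on U" "b holomorphic_on U"
    "\<And>w. w \<in> U \<Longrightarrow> deriv h w = (a w)\<^sup>2" "\<And>w. w \<in> U \<Longrightarrow> deriv g w = (b w)\<^sup>2"
    "\<And>w. w \<in> U \<Longrightarrow> k w = a w * b w" "\<And>w. w \<in> U \<Longrightarrow> a w \<noteq> 0 \<or> b w \<noteq> 0"
    using local_spinors[OF assms] by blast
  then show ?thesis by (intro log_factor_derivatives(2)[of U z a b])
qed

lemma weight_log_z_riccati:
  assumes \<rho>: "smooth_on \<rho> \<bbbD>" and z: "z \<in> \<bbbD>" "sqdist A z \<noteq> 0"
  defines "\<rho>\<^sub>c \<equiv> \<lambda>w. complex_of_real (\<rho> w)"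
  assumes bound: "norm (harmonic_schwarzian h g z
        - 2 * (wirtinger (wirtinger \<rho>\<^sub>c) z - (wirtinger \<rho>\<^sub>c z)\<^sup>2))
      + exp (2 * log_factor h g z) * \<bar>gauss_curvature h g z\<bar>
      \<le> 2 * M + 2 * Re (wirtinger_bar (wirtinger \<rho>\<^sub>c) z)"
  obtains p q where "has_wirtinger (weight_log_z A \<rho>) p q z"
    "\<And>v. Re ((p * v + q * cnj v) * v + weight_log_z A \<rho> z * (- 2 * wirtinger \<rho>\<^sub>c z * v\<^sup>2))
       + (Re (weight_log_z A \<rho> z * v))\<^sup>2 \<ge> - (M * (norm v)\<^sup>2)"
proof -
  obtain U a b where U: "open U" "z \<in> U" "U \<subseteq> \<bbbD>" "a holomorphic_on U" "b holomorphic_on U"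
    and ha: "\<And>w. w \<in> U \<Longrightarrow> deriv h w = (a w)\<^sup>2" and gb: "\<And>w. w \<in> U \<Longrightarrow> deriv g w = (b w)\<^sup>2"
    and kab: "\<And>w. w \<in> U \<Longrightarrow> k w = a w * b w" and nz: "\<And>w. w \<in> U \<Longrightarrow> a w \<noteq> 0 \<or> b w \<noteq> 0"
    using local_spinors[OF z(1)] by blast
  define E where "E = a z * cnj (a z) + b z * cnj (b z)"
  define \<omega> where "\<omega> = deriv a z * b z - a z * deriv b z"
  have L: "wirtinger log_factor\<^sub>c z = (deriv a z * cnj (a z) + deriv b z * cnj (b z)) / E"
    "has_wirtinger (wirtinger log_factor\<^sub>c) (wirtinger (wirtinger log_factor\<^sub>c) z)
       (\<omega> * cnj \<omega> / E\<^sup>2) z"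
    "laplacian (log_factor h g) z = 4 * (norm \<omega> / norm E)\<^sup>2"
    unfolding E_def \<omega>_def
    by (rule log_factor_derivatives(1,3,4)[OF U(1,2,4,5)]; use ha gb nz in blast)+
  note R = smooth_on_has_wirtinger[OF \<rho> open_ball z(1), folded \<rho>\<^sub>c_def]
  note N = has_wirtinger_sqdist[OF z(1), of A]
  note Nz = has_wirtinger_sqdist_z[OF U ha gb kab, of A, folded E_def]
  have "E \<noteq> 0"
  proof -
    have "(norm (a z))\<^sup>2 + (norm (b z))\<^sup>2 \<noteq> 0"
      using nz[OF U(2)] by (simp add: sum_power2_eq_zero_iff)
    moreover have "E = complex_of_real ((norm (a z))\<^sup>2 + (norm (b z))\<^sup>2)"
      by (simp add: E_def flip: complex_norm_square)
    ultimately show ?thesis by (metis of_real_eq_0_iff)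
  qed
  have N0: "complex_of_real (sqdist A z) \<noteq> 0" using z(2) by simp
  have K: "exp (2 * log_factor h g z) * \<bar>gauss_curvature h g z\<bar> = 4 * (norm \<omega> / norm E)\<^sup>2"
  proof -
    have "exp (2 * log_factor h g z) * exp (- 2 * log_factor h g z) = 1"
      by (simp flip: exp_add)
    moreover have "\<bar>gauss_curvature h g z\<bar>
        = exp (- 2 * log_factor h g z) * (4 * (norm \<omega> / norm E)\<^sup>2)"
      unfolding gauss_curvature_def L(3) by (simp add: abs_mult)
    ultimately show ?thesis by (simp only: mult.assoc[symmetric] mult_1_left)
  qed
  have bound': "norm (2 * (wirtinger (wirtinger log_factor\<^sub>c) z - (wirtinger log_factor\<^sub>c z)\<^sup>2)
        - 2 * (wirtinger (wirtinger \<rho>\<^sub>c) z - (wirtinger \<rho>\<^sub>c z)\<^sup>2)) + 4 * (norm \<omega> / norm E)\<^sup>2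
      \<le> 2 * M + 2 * Re (wirtinger_bar (wirtinger \<rho>\<^sub>c) z)"
    using bound unfolding K harmonic_schwarzian_def Let_def .
  note D = has_wirtinger_diff[OF has_wirtinger_add[OF has_wirtinger_divide[OF Nz N N0] R(2)] L(2)]
  have sz: "sqdist_z A z = (a z)\<^sup>2 * cnj (plane_diff A z) + (b z)\<^sup>2 * plane_diff A z
      - 2 * \<i> * a z * b z * height_diff A z"
    by (simp add: sqdist_z_def ha[OF U(2)] gb[OF U(2)] kab[OF U(2)] mult.assoc)
  note bd = riccati_bound[of "a z" "b z" "plane_diff A z" "height_diff A z"
      "wirtinger (wirtinger log_factor\<^sub>c) z" "deriv a z" "deriv b z" "wirtinger (wirtinger \<rho>\<^sub>c) z"
      "wirtinger \<rho>\<^sub>c z" M "wirtinger_bar (wirtinger \<rho>\<^sub>c) z",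
      folded E_def \<omega>_def sz sqdist_complex, folded L(1), OF \<open>E \<noteq> 0\<close> N0 bound']
  show thesis
  proof (rule that)
    show "has_wirtinger (weight_log_z A \<rho>) 
      ((2 * a z * deriv a z * cnj (plane_diff A z) + 2 * b z * deriv b z * plane_diff A z
       - 2 * \<i> * (deriv a z * b z + a z * deriv b z) * height_diff A z) / sqdist A z
       - (sqdist_z A z)\<^sup>2 / (complex_of_real (sqdist A z))\<^sup>2
       + wirtinger (wirtinger \<rho>\<^sub>c) z - wirtinger (wirtinger log_factor\<^sub>c) z)
      (E\<^sup>2 / sqdist A z - sqdist_z A z * cnj (sqdist_z A z) / (complex_of_real (sqdist A z))\<^sup>2
       + wirtinger_bar (wirtinger \<rho>\<^sub>c) z - \<omega> * cnj \<omega> / E\<^sup>2) z"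
      using D unfolding weight_log_z_def[abs_def] \<rho>\<^sub>c_def by (simp only: power2_eq_square)
  qed (use bd in \<open>simp only: weight_log_z_def flip: \<rho>\<^sub>c_def\<close>)
qed

lemma weight_derivative_along:
  assumes \<rho>: "smooth_on \<rho> \<bbbD>" and t: "\<gamma> t \<in> \<bbbD>" "sqdist A (\<gamma> t) \<noteq> 0"
    and \<gamma>: "(\<gamma> has_vector_derivative v) (at t)"
  shows "((\<lambda>s. weight A \<rho> (\<gamma> s)) has_real_derivative
      weight A \<rho> (\<gamma> t) * Re (weight_log_z A \<rho> (\<gamma> t) * v)) (at t)"
proof -
  let ?r = "wirtinger (\<lambda>w. complex_of_real (\<rho> w)) (\<gamma> t)"
  let ?s = "wirtinger log_factor\<^sub>c (\<gamma> t)"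
  let ?N = "sqdist A (\<gamma> t)"
  have pos: "?N > 0" using t(2) by (simp add: sqdist_def sum_power2_gt_zero_iff) 
  have n: "((\<lambda>s. sqdist A (\<gamma> s)) has_real_derivative 2 * Re (sqdist_z A (\<gamma> t) * v)) (at t)"
    by (rule has_real_derivative_compose_wirtinger[OF has_wirtinger_sqdist[OF t(1)] \<gamma>])
  have r: "((\<lambda>s. \<rho> (\<gamma> s)) has_real_derivative 2 * Re (?r * v)) (at t)"
    by (rule has_real_derivative_compose_wirtinger[OF
        smooth_on_has_wirtinger(1)[OF \<rho> open_ball t(1)] \<gamma>])
  have s: "((\<lambda>s. log_factor h g (\<gamma> s)) has_real_derivative 2 * Re (?s * v)) (at t)"
    by (rule has_real_derivative_compose_wirtinger[OF has_wirtinger_log_factor[OF t(1)] \<gamma>])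
  have sq: "((\<lambda>s. sqrt (sqdist A (\<gamma> s))) has_real_derivative
      sqrt ?N * (Re (sqdist_z A (\<gamma> t) * v) / ?N)) (at t)"
  proof (rule DERIV_cong[OF DERIV_chain2[OF DERIV_real_sqrt[OF pos] n]])
    have "inverse (sqrt ?N) = sqrt ?N / ?N"
      using pos by (simp add: field_simps)
    then show "inverse (sqrt ?N) / 2 * (2 * Re (sqdist_z A (\<gamma> t) * v))
        = sqrt ?N * (Re (sqdist_z A (\<gamma> t) * v) / ?N)" by (simp del: times_complex.sel)
  qed
  have ex: "((\<lambda>s. exp ((\<rho> (\<gamma> s) - log_factor h g (\<gamma> s)) / 2)) has_real_derivative
      exp ((\<rho> (\<gamma> t) - log_factor h g (\<gamma> t)) / 2) * (Re (?r * v) - Re (?s * v))) (at t)"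
    by (auto intro!: derivative_eq_intros r s simp del: times_complex.sel)
  have Q: "Re (weight_log_z A \<rho> (\<gamma> t) * v)
      = Re (sqdist_z A (\<gamma> t) * v) / ?N + (Re (?r * v) - Re (?s * v))"
  proof -
    have "weight_log_z A \<rho> (\<gamma> t) * v = sqdist_z A (\<gamma> t) * v / complex_of_real ?N + (?r * v - ?s * v)"
      by (simp add: weight_log_z_def algebra_simps)
    then show ?thesis by (simp only: plus_complex.sel minus_complex.sel Re_divide_of_real)
  qed
  show ?thesis
    unfolding weight_def Q using DERIV_mult[OF sq ex] 
    by (rule DERIV_cong) (simp only: algebra_simps)
qed

text \<open>
  The lift is an immersion, so it cannot be constant along a curve with nonzero velocity. With
  \<open>u = h' \<gamma>'\<close> and \<open>m = g' \<gamma>'\<close>, constancy of the lift means that \<open>u = - cnj m\<close> and that \<open>\<kappa> = k \<gamma>'\<close> is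
  real; then \<open>\<kappa>\<^sup>2 = u m = - |m|\<^sup>2\<close> forces both sides to vanish.
\<close>
lemma sqdist_not_identically_zero_along:
  assumes \<gamma>: "\<And>t. t \<in> {0..1} \<Longrightarrow> \<gamma> t \<in> \<bbbD>"
    "\<And>t. t \<in> {0..1} \<Longrightarrow> (\<gamma> has_vector_derivative \<gamma>' t) (at t within {0..1})"
    and "s \<in> {0..1}" "\<gamma>' s \<noteq> 0"
  shows "\<exists>t\<in>{0..1}. sqdist A (\<gamma> t) \<noteq> 0"
proof (rule ccontr)
  assume "\<not> ?thesis"
  then have 0: "plane_diff A (\<gamma> t) = 0" "height_diff A (\<gamma> t) = 0" if "t \<in> {0..1}" for t
    using that by (auto simp: sqdist_def sum_power2_eq_zero_iff)
  let ?z = "\<gamma> s" and ?v = "\<gamma>' s"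
  note d = has_vector_derivative_compose_wirtinger[OF _ \<gamma>(2)[OF \<open>s \<in> {0..1}\<close>]]
  note c = coordinate_derivatives[OF \<gamma>(1)[OF \<open>s \<in> {0..1}\<close>], of A]
  have const: "D = 0" if "(F has_vector_derivative D) (at s within {0..1})"
    "\<And>t. t \<in> {0..1} \<Longrightarrow> F t = 0" for F :: "real \<Rightarrow> complex" and D
  proof -
    have "((\<lambda>t. 0) has_vector_derivative D) (at s within {0..1})"
      by (rule has_vector_derivative_transform[OF _ _ that(1)]) (use that(2) \<open>s \<in> {0..1}\<close> in auto)
    moreover have "((\<lambda>t::real. 0 :: complex) has_vector_derivative 0) (at s within {0..1})" by simp
    ultimately show ?thesis
      using \<open>s \<in> {0..1}\<close> vector_derivative_unique_within_closed_interval[of 0 1 s "\<lambda>t. 0" D 0]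
      by simp
  qed
  define u where "u = deriv h ?z * ?v"
  define m where "m = deriv g ?z * ?v"
  define \<kappa> where "\<kappa> = k ?z * ?v"
  have 1: "u + cnj m = 0"
    using const[OF d[OF c(1)]] 0(1) by (simp add: u_def m_def)
  have 2: "cnj \<kappa> = \<kappa>"
    using const[OF d[OF c(2)]] 0(2) by (simp add: \<kappa>_def algebra_simps)
  have "\<kappa>\<^sup>2 = u * m"
    using square[OF \<gamma>(1)[OF \<open>s \<in> {0..1}\<close>]]
    by (simp add: \<kappa>_def u_def m_def power_mult_distrib power2_eq_square)
  moreover have "u = - cnj m" using 1 by (simp add: eq_neg_iff_add_eq_0)
  ultimately have "\<kappa> * cnj \<kappa> = - (m * cnj m)" using 2 by (simp add: power2_eq_square)
  then have "complex_of_real ((norm \<kappa>)\<^sup>2 + (norm m)\<^sup>2) = 0"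
    unfolding of_real_add complex_norm_square by simp
  then have "(norm \<kappa>)\<^sup>2 + (norm m)\<^sup>2 = 0" by (metis of_real_eq_0_iff)
  then have "m = 0" by (simp add: sum_power2_eq_zero_iff)
  with \<open>u = - cnj m\<close> have "u = 0" by simp
  with \<open>m = 0\<close> show False
    using immersed[OF \<gamma>(1)[OF \<open>s \<in> {0..1}\<close>]] \<open>\<gamma>' s \<noteq> 0\<close> by (auto simp: u_def m_def)
qed

text \<open>
  The right-hand side of the bound is chosen so that \<open>(\<mu> / c)\<^sup>2 e\<^bsup>2\<rho>\<^esup> |\<gamma>'|\<^sup>2 = \<mu>\<^sup>2\<close>, as \<open>e\<^sup>\<rho> |\<gamma>'| = c\<close> along
  the geodesic. The comparison runs between two zeros of the distance that have no zero between them.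
\<close>
lemma sqdist_along_geodesic_nonzero:
  assumes \<rho>: "smooth_on \<rho> \<bbbD>" and geo: "conformal_geodesic \<rho> \<gamma>" and "\<gamma> 0 \<noteq> \<gamma> 1"
    and \<mu>: "0 < \<mu>" "\<mu> < pi"
  defines "\<rho>\<^sub>c \<equiv> \<lambda>w. complex_of_real (\<rho> w)" and "c \<equiv> conformal_length \<rho> \<gamma>"
  assumes bound: "\<And>z. z \<in> \<bbbD> \<Longrightarrow> norm (harmonic_schwarzian h g z
        - 2 * (wirtinger (wirtinger \<rho>\<^sub>c) z - (wirtinger \<rho>\<^sub>c z)\<^sup>2))
      + exp (2 * log_factor h g z) * \<bar>gauss_curvature h g z\<bar>
      \<le> 2 * ((\<mu> / c)\<^sup>2 * exp (2 * \<rho> z)) + 2 * Re (wirtinger_bar (wirtinger \<rho>\<^sub>c) z)"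
  shows "sqdist (\<gamma> 0) (\<gamma> 1) \<noteq> 0"
proof
  assume end0: "sqdist (\<gamma> 0) (\<gamma> 1) = 0"
  let ?A = "\<gamma> 0"
  obtain \<gamma>' where inD: "\<And>t. t \<in> {0..1} \<Longrightarrow> \<gamma> t \<in> \<bbbD>"
    and d: "\<And>t. t \<in> {0..1} \<Longrightarrow> (\<gamma> has_vector_derivative \<gamma>' t) (at t within {0..1})"
    and dd: "\<And>t. t \<in> {0..1} \<Longrightarrow> (\<gamma>' has_vector_derivative
        - 2 * wirtinger \<rho>\<^sub>c (\<gamma> t) * (\<gamma>' t)\<^sup>2) (at t within {0..1})"
    and speed: "\<And>t. t \<in> {0..1} \<Longrightarrow> exp (\<rho> (\<gamma> t)) * norm (\<gamma>' t) = c"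
    using conformal_geodesic_constant_speed[OF \<rho> geo] unfolding \<rho>\<^sub>c_def c_def by blast
  have "c \<noteq> 0" unfolding c_def using conformal_geodesic_length_pos[OF \<rho> geo \<open>\<gamma> 0 \<noteq> \<gamma> 1\<close>] by simp
  have contn: "continuous_on {0..1} (\<lambda>t. sqdist ?A (\<gamma> t))"
    unfolding continuous_on_eq_continuous_within
  proof
    fix t :: real assume t: "t \<in> {0..1}"
    show "continuous (at t within {0..1}) (\<lambda>t. sqdist ?A (\<gamma> t))"
      by (rule has_real_derivative_compose_wirtinger[OF has_wirtinger_sqdist[OF inD[OF t]] d[OF t],
            THEN DERIV_continuous])
  qed
  have conts: "continuous_on {0..1} (\<lambda>t. \<rho> (\<gamma> t) - log_factor h g (\<gamma> t))"
    unfolding continuous_on_eq_continuous_within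
  proof
    fix t :: real assume t: "t \<in> {0..1}"
    show "continuous (at t within {0..1}) (\<lambda>t. \<rho> (\<gamma> t) - log_factor h g (\<gamma> t))"
      by (intro continuous_intros
          has_real_derivative_compose_wirtinger[OF smooth_on_has_wirtinger(1)[OF \<rho> open_ball inD[OF t]] d[OF t],
            THEN DERIV_continuous]
          has_real_derivative_compose_wirtinger[OF has_wirtinger_log_factor[OF inD[OF t]] d[OF t],
            THEN DERIV_continuous])
  qed
  have "\<gamma>' 0 \<noteq> 0" using speed[of 0] \<open>c \<noteq> 0\<close> by auto
  then obtain t\<^sub>0 where t0: "t\<^sub>0 \<in> {0..1}" "sqdist ?A (\<gamma> t\<^sub>0) \<noteq> 0"
    using sqdist_not_identically_zero_along[OF inD d, of 0 ?A] by auto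
  have "sqdist ?A (\<gamma> 0) = 0" by (simp add: sqdist_def plane_diff_def height_diff_def)
  then obtain \<alpha> \<beta> where ab: "0 \<le> \<alpha>" "\<alpha> < \<beta>" "\<beta> \<le> 1"
    and ends: "sqdist ?A (\<gamma> \<alpha>) = 0" "sqdist ?A (\<gamma> \<beta>) = 0"
    and nz: "\<And>t. t \<in> {\<alpha><..<\<beta>} \<Longrightarrow> sqdist ?A (\<gamma> t) \<noteq> 0"
    using zero_free_gap[OF contn _ end0 t0] by blast
  define w where "w t = weight ?A \<rho> (\<gamma> t)" for t
  define m where "m t = Re (weight_log_z ?A \<rho> (\<gamma> t) * \<gamma>' t)" for t
  have int: "t \<in> {0..1}" "at t within {0..1} = at t" if "t \<in> {\<alpha><..<\<beta>}" for t
    using that ab by (auto intro!: at_within_interior)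
  have wpos: "w t > 0" if "t \<in> {\<alpha><..<\<beta>}" for t
  proof -
    have "sqdist ?A (\<gamma> t) > 0"
      using nz[OF that] by (simp add: sqdist_def sum_power2_gt_zero_iff)
    then show ?thesis by (simp add: w_def weight_def)
  qed
  have w': "(w has_real_derivative w t * m t) (at t)" if "t \<in> {\<alpha><..<\<beta>}" for t
    unfolding w_def m_def
    by (rule weight_derivative_along[OF \<rho>, where \<gamma> = \<gamma>,
          OF inD[OF int(1)[OF that]] nz[OF that] d[OF int(1)[OF that], unfolded int(2)[OF that]]])
  have ric: "\<exists>m'. (m has_real_derivative m') (at t) \<and> m' + (m t)\<^sup>2 \<ge> - \<mu>\<^sup>2"
    if t: "t \<in> {\<alpha><..<\<beta>}" for t
  proof -
    let ?v = "\<gamma>' t" and ?g = "- 2 * wirtinger \<rho>\<^sub>c (\<gamma> t) * (\<gamma>' t)\<^sup>2"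
    obtain p q where pq: "has_wirtinger (weight_log_z ?A \<rho>) p q (\<gamma> t)"
      and ineq: "\<And>v. Re ((p * v + q * cnj v) * v
           + weight_log_z ?A \<rho> (\<gamma> t) * (- 2 * wirtinger \<rho>\<^sub>c (\<gamma> t) * v\<^sup>2))
         + (Re (weight_log_z ?A \<rho> (\<gamma> t) * v))\<^sup>2 \<ge> - ((\<mu> / c)\<^sup>2 * exp (2 * \<rho> (\<gamma> t)) * (norm v)\<^sup>2)"
      using weight_log_z_riccati[OF \<rho> inD[OF int(1)[OF t]] nz[OF t]]
        bound[OF inD[OF int(1)[OF t]]] unfolding \<rho>\<^sub>c_def by blast
    have "((\<lambda>s. weight_log_z ?A \<rho> (\<gamma> s)) has_vector_derivative p * ?v + q * cnj ?v) (at t)"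
      using has_vector_derivative_compose_wirtinger[OF pq d[OF int(1)[OF t]]]
      unfolding int(2)[OF t] .
    from has_vector_derivative_mult[OF this dd[OF int(1)[OF t], unfolded int(2)[OF t]]]
    have "((\<lambda>s. weight_log_z ?A \<rho> (\<gamma> s) * \<gamma>' s) has_vector_derivative
        ((p * ?v + q * cnj ?v) * ?v + weight_log_z ?A \<rho> (\<gamma> t) * ?g)) (at t)"
      by (simp add: add.commute)
    from bounded_linear.has_vector_derivative[OF bounded_linear_Re this]
    have "(m has_real_derivative
        Re ((p * ?v + q * cnj ?v) * ?v + weight_log_z ?A \<rho> (\<gamma> t) * ?g)) (at t)"
      unfolding has_real_derivative_iff_has_vector_derivative m_def[abs_def] .
    moreover have "(\<mu> / c)\<^sup>2 * exp (2 * \<rho> (\<gamma> t)) * (norm ?v)\<^sup>2 = \<mu>\<^sup>2"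
    proof -
      have "(\<mu> / c)\<^sup>2 * exp (2 * \<rho> (\<gamma> t)) * (norm ?v)\<^sup>2 = (\<mu> / c * (exp (\<rho> (\<gamma> t)) * norm ?v))\<^sup>2"
        by (simp add: power_mult_distrib power_divide exp_double)
      then show ?thesis using speed[OF int(1)[OF t]] \<open>c \<noteq> 0\<close> by simp
    qed
    ultimately show ?thesis using ineq[of ?v] unfolding m_def by metis
  qed
  then obtain m' where m': "\<And>t. t \<in> {\<alpha><..<\<beta>} \<Longrightarrow> (m has_real_derivative m' t) (at t)"
    "\<And>t. t \<in> {\<alpha><..<\<beta>} \<Longrightarrow> m' t + (m t)\<^sup>2 \<ge> - \<mu>\<^sup>2" by metis
  have "w \<beta> > 0"
  proof (rule sturm_positive[where w = w and \<alpha> = \<alpha> and \<beta> = \<beta> and \<mu> = \<mu>])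
    show "\<alpha> < \<beta>" "0 < \<mu>" by fact+
    show "\<mu> * (\<beta> - \<alpha>) < pi"
    proof -
      have "\<mu> * (\<beta> - \<alpha>) \<le> \<mu> * 1"
        using ab \<mu>(1) by (intro mult_left_mono) auto
      then show ?thesis using \<mu>(2) by simp
    qed
    have "continuous_on {0..1} w"
      unfolding w_def weight_def by (intro continuous_intros contn conts) auto
    then show "continuous_on {\<alpha>..\<beta>} w"
      by (rule continuous_on_subset) (use ab in auto)
    show "w \<alpha> = 0" using ends(1) by (simp add: w_def weight_def)
    fix t assume t: "t \<in> {\<alpha><..<\<beta>}"
    show "w t > 0" "(w has_real_derivative w t * m t) (at t)" using wpos[OF t] w'[OF t] by auto
    show "((\<lambda>t. w t * m t) has_real_derivative w t * (m' t + (m t)\<^sup>2)) (at t)"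
      using DERIV_mult[OF w'[OF t] m'(1)[OF t]]
      by (rule DERIV_cong) (simp add: algebra_simps power2_eq_square)
    show "w t * (m' t + (m t)\<^sup>2) \<ge> - (\<mu>\<^sup>2 * w t)"
      using mult_left_mono[OF m'(2)[OF t], of "w t"] wpos[OF t] by (simp add: mult.commute)
  qed
  then show False using ends(2) by (simp add: w_def weight_def)
qed

end

section \<open>Injectivity of the lift\<close>

theorem theorem4p1:
  fixes f h g q :: "complex \<Rightarrow> complex" and z\<^sub>0 :: complex
    and \<rho> :: "complex \<Rightarrow> real" and \<delta> :: ereal
  defines "\<rho>\<^sub>c \<equiv> \<lambda>w. complex_of_real (\<rho> w)"
  assumes "harmonic_mapping f h g"
    and "dilatation_is_square h g q"
    and "z\<^sub>0 \<in> \<bbbD>"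
    and "smooth_on \<rho> \<bbbD>"
    and "0 < \<delta>"
    and "\<And>a b. \<lbrakk>a \<in> \<bbbD>; b \<in> \<bbbD>\<rbrakk> \<Longrightarrow>
           \<exists>\<gamma>. conformal_geodesic \<rho> \<gamma> \<and> pathstart \<gamma> = a \<and> pathfinish \<gamma> = b \<and>
               ereal (conformal_length \<rho> \<gamma>) < \<delta>"
    and "\<And>z. z \<in> \<bbbD> \<Longrightarrow>
           ereal (norm (harmonic_schwarzian h g z
                          - 2 * (wirtinger (wirtinger \<rho>\<^sub>c) z - (wirtinger \<rho>\<^sub>c z)\<^sup>2))
                  + exp (2 * log_factor h g z) * \<bar>gauss_curvature h g z\<bar>)
           \<le> ereal (2 * pi\<^sup>2 * exp (2 * \<rho> z)) / \<delta>\<^sup>2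
             + ereal (2 * Re (wirtinger_bar (wirtinger \<rho>\<^sub>c) z))"
  shows "inj_on (lift f h q z\<^sub>0) \<bbbD>"
proof (rule inj_onI, rule ccontr)
  fix a b assume a: "a \<in> \<bbbD>" and b: "b \<in> \<bbbD>" and eq: "lift f h q z\<^sub>0 a = lift f h q z\<^sub>0 b" and "a \<noteq> b"
  have hm: "h holomorphic_on \<bbbD>" "g holomorphic_on \<bbbD>"
    "\<And>z. z \<in> \<bbbD> \<Longrightarrow> f z = h z + cnj (g z)"
    "\<And>z. z \<in> \<bbbD> \<Longrightarrow> deriv h z \<noteq> 0 \<or> deriv g z \<noteq> 0"
    using \<open>harmonic_mapping f h g\<close>[unfolded harmonic_mapping_def] norm_zero add_0
    by metis+
  obtain P k where P: "\<And>z. z \<in> \<bbbD> \<Longrightarrow> (P has_field_derivative k z) (at z)"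
    and k: "\<And>z. z \<in> \<bbbD> \<Longrightarrow> (k z)\<^sup>2 = deriv h z * deriv g z"
    and int: "\<And>a z. a \<in> \<bbbD> \<Longrightarrow> z \<in> \<bbbD> \<Longrightarrow>
       contour_integral (linepath a z) (\<lambda>\<zeta>. deriv h \<zeta> * q \<zeta>) = P z - P a"
    using third_coordinate_primitive[OF hm(1,2) \<open>dilatation_is_square h g q\<close>] by blast
  interpret weierstrass_data h g k P
    by unfold_locales (use hm(1,2,4) P k in blast)+
  have "Re (f a) = Re (f b)" "Im (f a) = Im (f b)" "Im (P a) = Im (P b)"
  proof -
    have "lift f h q z\<^sub>0 a $ i = lift f h q z\<^sub>0 b $ i" for i using eq by simp
    from this[of 1] this[of 2] this[of 3]
    show "Re (f a) = Re (f b)" "Im (f a) = Im (f b)" "Im (P a) = Im (P b)"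
      unfolding lift_def int[OF \<open>z\<^sub>0 \<in> \<bbbD>\<close> a] int[OF \<open>z\<^sub>0 \<in> \<bbbD>\<close> b] by simp_all
  qed
  then have same: "sqdist a b = 0"
    unfolding sqdist_def plane_diff_def height_diff_def
    using hm(3)[OF a] hm(3)[OF b] by (auto simp: complex_eq_iff)
  obtain \<gamma> where geo: "conformal_geodesic \<rho> \<gamma>" and \<gamma>: "\<gamma> 0 = a" "\<gamma> 1 = b"
    and short: "ereal (conformal_length \<rho> \<gamma>) < \<delta>"
    using assms(7)[OF a b] by (auto simp: pathstart_def pathfinish_def)
  define c where "c = conformal_length \<rho> \<gamma>"
  have "c > 0"
    unfolding c_def using conformal_geodesic_length_pos[OF \<open>smooth_on \<rho> \<bbbD>\<close> geo] \<gamma> \<open>a \<noteq> b\<close> by simp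
  \<comment> \<open>For finite \<open>\<delta>\<close> this choice makes \<open>(\<mu> / c)\<^sup>2 = \<pi>\<^sup>2 / \<delta>\<^sup>2\<close>. For infinite \<open>\<delta>\<close> the term to be
    bounded is \<open>0\<close>, and any value between \<open>0\<close> and \<open>\<pi>\<close> serves.\<close>
  obtain \<mu> where \<mu>: "0 < \<mu>" "\<mu> < pi"
    and bound: "\<And>x y z. ereal x \<le> ereal (2 * pi\<^sup>2 * exp (2 * \<rho> z)) / \<delta>\<^sup>2 + ereal y \<Longrightarrow>
      x \<le> 2 * ((\<mu> / c)\<^sup>2 * exp (2 * \<rho> z)) + y"
  proof (cases \<delta>)
    case (real d)
    have d: "d > 0" "c < d" using \<open>0 < \<delta>\<close> short by (auto simp: real c_def)
    show ?thesis
    proof (rule that[of "pi * c / d"])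
      show "0 < pi * c / d" "pi * c / d < pi" using d \<open>c > 0\<close> by (simp_all add: field_simps)
      fix x y z assume "ereal x \<le> ereal (2 * pi\<^sup>2 * exp (2 * \<rho> z)) / \<delta>\<^sup>2 + ereal y"
      then have "x \<le> 2 * pi\<^sup>2 * exp (2 * \<rho> z) / d\<^sup>2 + y"
        using d(1) by (simp add: real)
      also have "2 * pi\<^sup>2 * exp (2 * \<rho> z) / d\<^sup>2 = 2 * ((pi * c / d / c)\<^sup>2 * exp (2 * \<rho> z))"
        using \<open>c > 0\<close> by (simp add: power_divide)
      finally show "x \<le> 2 * ((pi * c / d / c)\<^sup>2 * exp (2 * \<rho> z)) + y" .
    qed
  next
    case PInf
    show ?thesis
    proof (rule that[of 1])
      show "(0::real) < 1" "1 < pi" using pi_gt3 by auto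
      fix x y z assume "ereal x \<le> ereal (2 * pi\<^sup>2 * exp (2 * \<rho> z)) / \<delta>\<^sup>2 + ereal y"
      then have "x \<le> y" by (simp add: PInf power2_eq_square)
      moreover have "0 \<le> 2 * ((1 / c)\<^sup>2 * exp (2 * \<rho> z))" by simp
      ultimately show "x \<le> 2 * ((1 / c)\<^sup>2 * exp (2 * \<rho> z)) + y" by linarith
    qed
  next
    case MInf
    then show ?thesis using \<open>0 < \<delta>\<close> by simp
  qed
  have "sqdist (\<gamma> 0) (\<gamma> 1) \<noteq> 0"
    using sqdist_along_geodesic_nonzero[OF \<open>smooth_on \<rho> \<bbbD>\<close> geo _ \<mu>] \<open>a \<noteq> b\<close> \<gamma>
      bound[OF assms(8)] unfolding \<rho>\<^sub>c_def c_def by blast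
  with same \<gamma> show False by simp
qed

end
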